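(* Let $P=\{\xi\in\mathbb F_q^d:\xi_d=\xi_1^2+\cdots+\xi_{d-1}^2\}$ be the paraboloid and let $1\le p,r\le\infty$. Assume that $R_P^*(p\to r)\lesssim 1$. Then the following statements are true: (1) If $d\ge2$ is even, then $(1/p,1/r)$ is contained in the convex hull of the points $(1,0)$, $(0,0)$, $\left(0,\frac{d-1}{2d}\right)$ and $\left(\frac{d^2-d+2}{2d^2},\frac{d-1}{2d}\right)$. (2) If $d=4\ell-1$ for some $\ell\in\mathbb N=\{1,2,\dots\}$, and $-1\in\mathbb F_q$ is not a square, then $(1/p,1/r)$ is contained in the convex hull of the points $(1,0)$, $(0,0)$, $\left(0,\frac{d-1}{2d}\right)$ and $\left(\frac{d^2+3}{2d^2+2d},\frac{d-1}{2d}\right)$. (3) If $d=4\ell+1$ for some $\ell\in\mathbb N$, then $(1/p,1/r)$ is contained in the convex hull of the points $(1,0)$, $(0,0)$, $\left(0,\frac{d-1}{2d}\right)$ and $\left(\frac{d-1}{2d},\frac{d-1}{2d}\right)$. (4) If $d\ge3$ is odd, and $-1\in\mathbb F_q$ is a square, then $(1/p,1/r)$ is contained in the convex hull of the points $(1,0)$, $(0,0)$, $\left(0,\frac{d-1}{2d}\right)$ and $\left(\frac{d-1}{2d},\frac{d-1}{2d}\right)$.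
   Context: $\mathbb F_q$ is the finite field with $q$ elements, where $q$ is a power of an odd prime, and $\chi$ is a nontrivial additive character of $\mathbb F_q$. For $f:P\to\mathbb C$ define $$(fd\sigma)^\vee(m)=\frac1{|P|}\sum_{\xi\in P}f(\xi)\chi(m\cdot\xi),\qquad m\in\mathbb F_q^d.$$ Norms: $\|f\|_{L^p(P,d\sigma)}=\big(\frac1{|P|}\sum_{\xi\in P}|f(\xi)|^p\big)^{1/p}$, and $\|F\|_{L^r(\mathbb F_q^d,dm)}=\big(\sum_{m\in\mathbb F_q^d}|F(m)|^r\big)^{1/r}$ (counting measure), with the usual convention for exponent $\infty$ (and $1/\infty=0$). For $1\le p,r\le\infty$, $R_P^*(p\to r)$ is the smallest positive real number such that $\|(fd\sigma)^\vee\|_{L^r(\mathbb F_q^d,dm)}\le R_P^*(p\to r)\,\|f\|_{L^p(P,d\sigma)}$ for all $f:P\to\mathbb C$. The hypothesis $R_P^*(p\to r)\lesssim1$, for fixed $d,p,r$, means that there is a constant $C>0$ independent of $q$ with $R_P^*(p\to r)\le C$ for all admissible $q$; admissible means all odd prime powers in cases (1) and (3), all odd prime powers $q$ with $-1$ a non-square in $\mathbb F_q$ in case (2), and all odd prime powers $q$ with $-1$ a square in $\mathbb F_q$ in case (4). *)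

theory Defs
  imports
    "HOL-Analysis.Analysis"
    "HOL-Algebra.Algebra"
    "HOL-Number_Theory.Prime_Powers"
begin

text \<open>
  Constants have to be uniform in \<open>q\<close>, so the fields range over records of HOL-Algebra rather than
  over a type class.  Vectors of length \<open>d\<close> are extensional functions on \<open>{1..d}\<close>, so
  coordinates are numbered as \<open>\<xi>\<^sub>1, \<dots>, \<xi>\<^sub>d\<close>.
\<close>

definition vecs :: "'a ring \<Rightarrow> nat \<Rightarrow> (nat \<Rightarrow> 'a) set" where
  "vecs K d = ({1..d} \<rightarrow>\<^sub>E carrier K)"

definition dot :: "'a ring \<Rightarrow> nat \<Rightarrow> (nat \<Rightarrow> 'a) \<Rightarrow> (nat \<Rightarrow> 'a) \<Rightarrow> 'a" where
  "dot K d x y = (\<Oplus>\<^bsub>K\<^esub>i\<in>{1..d}. x i \<otimes>\<^bsub>K\<^esub> y i)"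

definition paraboloid :: "'a ring \<Rightarrow> nat \<Rightarrow> (nat \<Rightarrow> 'a) set" where
  "paraboloid K d =
     {\<xi> \<in> vecs K d. \<xi> d = (\<Oplus>\<^bsub>K\<^esub>i\<in>{1..d - 1}. \<xi> i [^]\<^bsub>K\<^esub> (2::nat))}"

definition additive_character :: "'a ring \<Rightarrow> ('a \<Rightarrow> complex) \<Rightarrow> bool" where
  "additive_character K chi \<longleftrightarrow>
     (\<forall>x\<in>carrier K. norm (chi x) = 1) \<and>
     (\<forall>x\<in>carrier K. \<forall>y\<in>carrier K. chi (x \<oplus>\<^bsub>K\<^esub> y) = chi x * chi y)"

definition nontrivial_additive_character :: "'a ring \<Rightarrow> ('a \<Rightarrow> complex) \<Rightarrow> bool" where
  "nontrivial_additive_character K chi \<longleftrightarrow>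
     additive_character K chi \<and> (\<exists>x\<in>carrier K. chi x \<noteq> 1)"

definition minus_one_is_square :: "'a ring \<Rightarrow> bool" where
  "minus_one_is_square K \<longleftrightarrow> (\<exists>y\<in>carrier K. y [^]\<^bsub>K\<^esub> (2::nat) = \<ominus>\<^bsub>K\<^esub> \<one>\<^bsub>K\<^esub>)"

text \<open>
  The \<open>L\<^sup>p\<close> norm on a finite nonempty set \<open>A\<close> in which every point has mass \<open>w > 0\<close>; since no point
  is a null set, the essential supremum is a maximum.
\<close>

definition Lp_norm :: "real \<Rightarrow> 'i set \<Rightarrow> ennreal \<Rightarrow> ('i \<Rightarrow> complex) \<Rightarrow> real" where
  "Lp_norm w A p f =
     (if p = \<infinity> then Max ((\<lambda>x. norm (f x)) ` A)
      else (w * (\<Sum>x\<in>A. norm (f x) powr enn2real p)) powr (1 / enn2real p))"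

definition surface_norm :: "'a ring \<Rightarrow> nat \<Rightarrow> ennreal \<Rightarrow> ((nat \<Rightarrow> 'a) \<Rightarrow> complex) \<Rightarrow> real" where
  "surface_norm K d p f = Lp_norm (1 / card (paraboloid K d)) (paraboloid K d) p f"

definition counting_norm :: "'a ring \<Rightarrow> nat \<Rightarrow> ennreal \<Rightarrow> ((nat \<Rightarrow> 'a) \<Rightarrow> complex) \<Rightarrow> real" where
  "counting_norm K d r F = Lp_norm 1 (vecs K d) r F"

text \<open>The function \<open>m \<mapsto> (f d\<sigma>)\<^sup>\<or>(m)\<close>; only the values of \<open>f\<close> on the paraboloid matter.\<close>

definition extension_op ::
    "'a ring \<Rightarrow> ('a \<Rightarrow> complex) \<Rightarrow> nat \<Rightarrow> ((nat \<Rightarrow> 'a) \<Rightarrow> complex) \<Rightarrow> (nat \<Rightarrow> 'a) \<Rightarrow> complex" where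
  "extension_op K chi d f m =
     1 / of_nat (card (paraboloid K d)) * (\<Sum>\<xi>\<in>paraboloid K d. f \<xi> * chi (dot K d m \<xi>))"

definition extension_const ::
    "'a ring \<Rightarrow> ('a \<Rightarrow> complex) \<Rightarrow> nat \<Rightarrow> ennreal \<Rightarrow> ennreal \<Rightarrow> real" where
  "extension_const K chi d p r =
     (LEAST C. 0 < C \<and>
        (\<forall>f. counting_norm K d r (extension_op K chi d f) \<le> C * surface_norm K d p f))"

text \<open>
  \<open>R\<^sub>P\<^sup>*(p \<rightarrow> r) \<lesssim> 1\<close>, uniformly over those odd prime powers \<open>q\<close> whose field \<open>K q\<close> satisfies \<open>adm\<close>.
  Here \<open>K q\<close> and \<open>chi q\<close> are the chosen field with \<open>q\<close> elements and nontrivial additive character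
  on it; such a family exists over every infinite \<open>'a\<close>, for instance \<open>nat\<close>.
\<close>

definition extension_bounded ::
    "('a ring \<Rightarrow> bool) \<Rightarrow> (nat \<Rightarrow> 'a ring) \<Rightarrow> (nat \<Rightarrow> 'a \<Rightarrow> complex) \<Rightarrow> nat \<Rightarrow> ennreal \<Rightarrow> ennreal \<Rightarrow> bool"
  where
  "extension_bounded adm K chi d p r \<longleftrightarrow>
     (\<exists>C>0. \<forall>q. primepow q \<and> odd q \<and> adm (K q) \<longrightarrow> extension_const (K q) (chi q) d p r \<le> C)"

text \<open>The point \<open>(1/p, 1/r)\<close>; in \<^typ>\<open>ennreal\<close>, \<open>1 / \<infinity> = 0\<close>.\<close>

definition exponent_point :: "ennreal \<Rightarrow> ennreal \<Rightarrow> real \<times> real" where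
  "exponent_point p r = (enn2real (1 / p), enn2real (1 / r))"

end

theory Submission imports Defs begin

text \<open>
  Two test functions suffice.  For \<open>f = 1\<close>, factoring into one-dimensional Gauss sums gives
  \<open>|(f d\<sigma>)\<^sup>\<or>(m)| = q^(-(d - 1)/2)\<close> whenever \<open>m\<^sub>d \<noteq> 0\<close>; letting \<open>q\<close> grow forces
  \<open>1/r \<le> (d - 1) / (2 d)\<close>.  For the indicator of a \<open>k\<close>-dimensional linear subspace \<open>H\<close> of the paraboloid,
  \<open>(f d\<sigma>)\<^sup>\<or> = |H| / |P|\<close> on the orthogonal complement of \<open>H\<close>, which forces
  \<open>(d - k) / r \<le> (d - 1 - k) (1 - 1/p)\<close>.  For the largest possible \<open>k\<close> these half-planes cut out the
  claimed trapezoids.  Infinitely many \<open>q\<close> are enough, so only powers of 3 are used: over \<open>q = 9^n\<close>,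
  where \<open>-1\<close> is a square, there is a subspace with \<open>k = \<lfloor>(d - 1) / 2\<rfloor>\<close>; over \<open>q = 3^(2n + 1)\<close>, where
  \<open>-1\<close> is not a square, the identity \<open>s\<^sup>2 + t\<^sup>2 + (s + t)\<^sup>2 + (s - t)\<^sup>2 = 0\<close> gives \<open>k = (d - 3) / 2\<close> for
  \<open>d = 4 l - 1\<close>.
\<close>

section \<open>Exponents and norms\<close>

lemma enn2real_inverse_exponent:
  fixes p :: ennreal
  assumes "1 \<le> p" "p \<noteq> \<infinity>"
  shows "1 \<le> enn2real p" "enn2real (1 / p) = 1 / enn2real p"
proof -
  obtain t where t: "0 \<le> t" "p = ennreal t"
    using assms(2) by (metis ennreal_cases infinity_ennreal_def)
  with assms have "1 \<le> t" by simp
  then show "1 \<le> enn2real p" "enn2real (1 / p) = 1 / enn2real p"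
    using t by (simp_all add: ennreal_1[symmetric] divide_ennreal del: ennreal_1)
qed

lemma exponent_bounds:
  fixes p :: ennreal
  assumes "1 \<le> p"
  shows "0 \<le> enn2real (1 / p)" "enn2real (1 / p) \<le> 1"
  using enn2real_inverse_exponent[OF assms] by (cases "p = \<infinity>"; simp)+

text \<open>Discard every point outside \<open>S\<close>. Writing the exponent as
  \<open>enn2real (1 / p)\<close> lets one bound serve all \<open>p\<close>, with exponent 0 at
  infinity.\<close>

lemma Lp_norm_ge:
  assumes "finite A" "S \<subseteq> A" "S \<noteq> {}" "0 < w" "1 \<le> p" "0 \<le> c"
    and c: "\<And>x. x \<in> S \<Longrightarrow> c \<le> norm (F x)"
  shows "(w * real (card S)) powr enn2real (1 / p) * c \<le> Lp_norm w A p F"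
proof -
  have S: "finite S" "0 < card S"
    using assms by (auto simp: card_gt_0_iff intro: finite_subset)
  show ?thesis
  proof (cases "p = \<infinity>")
    case True
    obtain x where "x \<in> S" using \<open>S \<noteq> {}\<close> by blast
    then have "c \<le> Max ((\<lambda>x. norm (F x)) ` A)"
      using assms by (intro order.trans[OF c Max_ge]) auto
    \<comment> \<open>The exponent is now 0, and \<open>powr 0\<close> gives 1 only for a nonzero
      base; hence the use of \<open>S\<close> being nonempty and \<open>w\<close> positive.\<close>
    then show ?thesis using True S \<open>0 < w\<close> \<open>S \<noteq> {}\<close> by (simp add: Lp_norm_def)
  next
    case False
    define t where "t = enn2real p"
    have t: "1 \<le> t" "enn2real (1 / p) = 1 / t"
      using enn2real_inverse_exponent[OF \<open>1 \<le> p\<close> False] by (simp_all add: t_def)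
    have "real (card S) * c powr t = (\<Sum>x\<in>S. c powr t)" by simp
    also have "\<dots> \<le> (\<Sum>x\<in>S. norm (F x) powr t)"
      using c t \<open>0 \<le> c\<close> by (intro sum_mono powr_mono2) auto
    also have "\<dots> \<le> (\<Sum>x\<in>A. norm (F x) powr t)"
      using assms by (intro sum_mono2) auto
    finally have "w * real (card S) * c powr t \<le> w * (\<Sum>x\<in>A. norm (F x) powr t)"
      using \<open>0 < w\<close> by simp
    then have "(w * real (card S) * c powr t) powr (1 / t) \<le> Lp_norm w A p F"
      using False t \<open>0 < w\<close> by (auto simp: Lp_norm_def t_def intro!: powr_mono2)
    moreover have "(w * real (card S) * c powr t) powr (1 / t)
        = (w * real (card S)) powr (1 / t) * c"
      using t \<open>0 < w\<close> \<open>0 \<le> c\<close> by (simp add: powr_mult powr_powr)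
    ultimately show ?thesis by (simp add: t)
  qed
qed

text \<open>Counterpart of \<open>Lp_norm_ge\<close>: together they compute the norm exactly for the
  constant 1 and for indicators.\<close>

lemma Lp_norm_le:
  assumes "finite A" "S \<subseteq> A" "S \<noteq> {}" "0 < w" "1 \<le> p" "0 \<le> c"
    and c: "\<And>x. x \<in> S \<Longrightarrow> norm (F x) \<le> c" and 0: "\<And>x. x \<in> A - S \<Longrightarrow> F x = 0"
  shows "Lp_norm w A p F \<le> (w * real (card S)) powr enn2real (1 / p) * c"
proof -
  have S: "finite S" "0 < card S"
    using assms by (auto simp: card_gt_0_iff intro: finite_subset)
  show ?thesis
  proof (cases "p = \<infinity>")
    case True
    have "norm (F x) \<le> c" if "x \<in> A" for x
      using that c[of x] 0[of x] \<open>0 \<le> c\<close> by (cases "x \<in> S") auto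
    moreover have "A \<noteq> {}" using \<open>S \<subseteq> A\<close> \<open>S \<noteq> {}\<close> by blast
    ultimately have "Max ((\<lambda>x. norm (F x)) ` A) \<le> c" using \<open>finite A\<close> by simp
    then show ?thesis using True S \<open>0 < w\<close> \<open>S \<noteq> {}\<close> by (simp add: Lp_norm_def)
  next
    case False
    define t where "t = enn2real p"
    have t: "1 \<le> t" "enn2real (1 / p) = 1 / t"
      using enn2real_inverse_exponent[OF \<open>1 \<le> p\<close> False] by (simp_all add: t_def)
    have "(\<Sum>x\<in>A. norm (F x) powr t) = (\<Sum>x\<in>S. norm (F x) powr t)"
      using assms by (intro sum.mono_neutral_right) auto
    also have "\<dots> \<le> (\<Sum>x\<in>S. c powr t)"
      using c t by (intro sum_mono powr_mono2) auto
    finally have "w * (\<Sum>x\<in>A. norm (F x) powr t) \<le> w * real (card S) * c powr t"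
      using \<open>0 < w\<close> by simp
    then have "Lp_norm w A p F \<le> (w * real (card S) * c powr t) powr (1 / t)"
      using False t \<open>0 < w\<close>
      by (auto simp: Lp_norm_def t_def intro!: powr_mono2 mult_nonneg_nonneg sum_nonneg)
    moreover have "(w * real (card S) * c powr t) powr (1 / t)
        = (w * real (card S)) powr (1 / t) * c"
      using t \<open>0 < w\<close> \<open>0 \<le> c\<close> by (simp add: powr_mult powr_powr)
    ultimately show ?thesis by (simp add: t)
  qed
qed

text \<open>The last hypothesis puts \<open>(a0, b0)\<close> on the line
  \<open>a + s * b = 1\<close>, which also passes through (1, 0). So the half-planes describe the
  trapezoid with this line as its slanted side, and it suffices to interpolate within a horizontal
  slice.\<close>

lemma mem_convex_hull_trapezoid:
  fixes a b a0 b0 s :: real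
  assumes "0 < a0" "0 < b0" "0 \<le> a" "0 \<le> b" "b \<le> b0" "a + s * b \<le> 1" "a0 + s * b0 = 1"
  shows "(a, b) \<in> convex hull {(1, 0), (0, 0), (0, b0), (a0, b0)}" (is "_ \<in> ?H")
proof -
  define t where "t = b / b0"
  define L where "L = 1 - s * b"
  have t: "0 \<le> t" "t \<le> 1" "b = t * b0" using assms by (auto simp: t_def)
  have "s * b0 = 1 - a0" using \<open>a0 + s * b0 = 1\<close> by linarith
  then have "s * b = t * (1 - a0)" using t(3) by (metis mult.left_commute)
  \<comment> \<open>\<open>L\<close> is the right end of the slice at height \<open>b\<close>. It
    interpolates between the right ends 1 and \<open>a0\<close> of the two parallel sides, so it is
    positive.\<close>
  then have L_eq: "L = (1 - t) + t * a0"
    by (simp add: L_def algebra_simps)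
  have "0 < L"
  proof (cases "t = 0")
    case False
    then have "0 < t * a0" using t assms by simp
    then show ?thesis using t L_eq by linarith
  qed (simp add: L_eq)
  \<comment> \<open>\<open>u\<close> is the relative position of \<open>a\<close> in its slice. The
    points at the same relative position on the bottom and top sides are \<open>(u, 0)\<close> and
    \<open>(u * a0, b0)\<close>, and \<open>(a, b)\<close> divides their segment in ratio
    \<open>t\<close>.\<close>
  define u where "u = a / L"
  have u: "0 \<le> u" "u \<le> 1" "a = u * L"
    using assms \<open>0 < L\<close> by (auto simp: u_def L_def)
  have mem: "(1 - v) *\<^sub>R x + v *\<^sub>R y \<in> ?H" if "x \<in> ?H" "y \<in> ?H" "0 \<le> v" "v \<le> 1" for x y v
    using that convex_convex_hull by (intro convexD_alt) auto
  have 1: "(u, 0) \<in> ?H" using mem[of "(0,0)" "(1,0)" u] u by (simp add: hull_inc)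
  have 2: "(u * a0, b0) \<in> ?H"
    using mem[of "(0,b0)" "(a0,b0)" u] u by (simp add: hull_inc algebra_simps)
  have "(a, b) = (1 - t) *\<^sub>R (u, 0) + t *\<^sub>R (u * a0, b0)"
    using u(3) t(3) by (simp add: L_eq algebra_simps)
  then show ?thesis using mem[OF 1 2, of t] t by simp
qed

text \<open>This turns a bound uniform in \<open>q\<close> into a linear inequality between
  exponents: a positive power of \<open>q\<close> would eventually exceed \<open>C\<close>.\<close>

lemma powr_unbounded:
  fixes C e :: real
  assumes "\<And>N. \<exists>q\<ge>N. 0 < q \<and> real q powr e \<le> C"
  shows "e \<le> 0"
proof (rule ccontr)
  assume "\<not> e \<le> 0"
  then have "0 < e" by simp
  define B where "B = \<bar>C\<bar> + 1"
  obtain N :: nat where N: "B powr (1 / e) \<le> real N" using real_arch_simple by blast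
  obtain q where q: "N \<le> q" "real q powr e \<le> C" using assms by blast
  have "B = (B powr (1 / e)) powr e" using \<open>0 < e\<close> by (simp add: powr_powr B_def)
  also have "\<dots> \<le> real q powr e" using \<open>0 < e\<close> N q by (intro powr_mono2) auto
  finally show False using q by (simp add: B_def)
qed

section \<open>Additive characters of a finite field\<close>

locale character_field = field K for K :: "'a ring" (structure) +
  fixes chi :: "'a \<Rightarrow> complex"
  assumes odd_card: "odd (card (carrier K))"
    and nontrivial: "nontrivial_additive_character K chi"
begin

abbreviation "q \<equiv> card (carrier K)"

lemma finite_carrier: "finite (carrier K)"
  using odd_card by (metis card.infinite even_zero)

lemma q_ge_2: "2 \<le> q"
proof -
  have "card {\<zero>, \<one>} \<le> q" using finite_carrier by (intro card_mono) auto
  then show ?thesis by simp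
qed

lemma norm_chi: "x \<in> carrier K \<Longrightarrow> norm (chi x) = 1"
  and chi_add: "x \<in> carrier K \<Longrightarrow> y \<in> carrier K \<Longrightarrow> chi (x \<oplus> y) = chi x * chi y"
  using nontrivial
  by (auto simp: nontrivial_additive_character_def additive_character_def)

lemma chi_zero: "chi \<zero> = 1"
  using chi_add[of \<zero> \<zero>] norm_chi[of \<zero>] by auto

lemma chi_finsum:
  assumes "finite A" "g \<in> A \<rightarrow> carrier K"
  shows "chi (finsum K g A) = (\<Prod>i\<in>A. chi (g i))"
  using assms
  by (induction A rule: finite_induct) (auto simp: chi_zero chi_add Pi_def)

text \<open>Translation by some \<open>z\<close> with \<open>chi z\<close> different from 1 permutes
  the field and multiplies the sum by \<open>chi z\<close>.\<close>

lemma sum_chi: "(\<Sum>x\<in>carrier K. chi x) = 0"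
proof -
  obtain z where z: "z \<in> carrier K" "chi z \<noteq> 1"
    using nontrivial by (auto simp: nontrivial_additive_character_def)
  have "(\<Sum>x\<in>carrier K. chi x) = (\<Sum>x\<in>carrier K. chi (z \<oplus> x))"
    using z(1) by (intro sum.reindex_bij_witness[of _ "\<lambda>x. z \<oplus> x" "\<lambda>x. \<ominus> z \<oplus> x"])
      (auto simp: a_assoc[symmetric] l_neg r_neg)
  also have "\<dots> = chi z * (\<Sum>x\<in>carrier K. chi x)"
    using z(1) by (simp add: chi_add sum_distrib_left)
  finally show ?thesis using z(2) by simp
qed

lemma sum_chi_mult:
  assumes c: "c \<in> carrier K"
  shows "(\<Sum>x\<in>carrier K. chi (c \<otimes> x)) = (if c = \<zero> then of_nat q else 0)"
proof (cases "c = \<zero>")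
  case False
  then have inv: "inv c \<in> carrier K" "inv c \<otimes> c = \<one>" "c \<otimes> inv c = \<one>"
    using c field_Units by auto
  have "(\<Sum>x\<in>carrier K. chi (c \<otimes> x)) = (\<Sum>x\<in>carrier K. chi x)"
    using c inv by (intro sum.reindex_bij_witness[of _ "\<lambda>x. inv c \<otimes> x" "\<lambda>x. c \<otimes> x"])
      (auto simp: m_assoc[symmetric])
  then show ?thesis using False sum_chi by simp
qed (simp add: chi_zero)

lemma card_add_pow: "a \<in> carrier K \<Longrightarrow> [q] \<cdot> a = \<zero>"
  using add.pow_order_eq_1[of a] by (simp add: Coset.order_def)

text \<open>Since \<open>q\<close> is odd and annihilates the additive group,
  \<open>a + a = 0\<close> would give \<open>a = q a = 0\<close>.\<close>

lemma double_nonzero: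
  assumes a: "a \<in> carrier K" "a \<noteq> \<zero>"
  shows "a \<oplus> a \<noteq> \<zero>"
proof
  assume 0: "a \<oplus> a = \<zero>"
  obtain j where j: "q = 2 * j + 1" using odd_card by (rule oddE)
  have "[(2::nat)] \<cdot> a = \<zero>" using 0 a by (simp add: numeral_2_eq_2)
  then have "[(2 * j)] \<cdot> a = \<zero>"
    using a add.nat_pow_pow[of a j 2] by (simp add: mult.commute)
  then have "[q] \<cdot> a = a" using a by (simp add: j)
  then show False using card_add_pow a by simp
qed

lemma square_add:
  assumes "x \<in> carrier K" "y \<in> carrier K"
  shows "(x \<oplus> y) [^] (2::nat) = x [^] (2::nat) \<oplus> (x \<otimes> y \<oplus> x \<otimes> y) \<oplus> y [^] (2::nat)"
  using assms by (simp add: numeral_2_eq_2 l_distr r_distr a_ac m_comm)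

text \<open>Expand the squared modulus as a double sum over x and y and substitute x = y + t. The
  phase difference is then affine in y, so orthogonality of characters leaves only t = 0, which
  contributes \<open>q\<close>.\<close>

lemma gauss_sum:
  assumes a: "a \<in> carrier K" "a \<noteq> \<zero>" and b: "b \<in> carrier K"
  shows "norm (\<Sum>x\<in>carrier K. chi (a \<otimes> x [^] (2::nat) \<oplus> b \<otimes> x)) = sqrt (real q)"
proof -
  define h where "h x = a \<otimes> x [^] (2::nat) \<oplus> b \<otimes> x" for x
  have h: "h x \<in> carrier K" if "x \<in> carrier K" for x
    using that a b by (simp add: h_def)
  \<comment> \<open>The difference \<open>h (y + t) - h y\<close> is \<open>h t + 2 a t y\<close>:
    the quadratic term in y cancels.\<close>
  have h_add: "h (y \<oplus> t) = h y \<oplus> (h t \<oplus> (a \<oplus> a) \<otimes> t \<otimes> y)"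
    if "y \<in> carrier K" "t \<in> carrier K" for y t
    using that a b by (simp add: h_def square_add l_distr r_distr a_ac m_ac)
  let ?G = "\<Sum>x\<in>carrier K. chi (h x)"
  have shift: "(\<Sum>x\<in>carrier K. chi (h x) * cnj (chi (h y)))
      = (\<Sum>t\<in>carrier K. chi (h t) * chi ((a \<oplus> a) \<otimes> t \<otimes> y))" if y: "y \<in> carrier K" for y
  proof -
    have "(\<Sum>x\<in>carrier K. chi (h x) * cnj (chi (h y)))
      = (\<Sum>t\<in>carrier K. chi (h (y \<oplus> t)) * cnj (chi (h y)))"
      using y by (intro sum.reindex_bij_witness[of _ "\<lambda>x. y \<oplus> x" "\<lambda>x. \<ominus> y \<oplus> x"])
        (auto simp: a_assoc[symmetric] l_neg r_neg)
    also have "\<dots> = (\<Sum>t\<in>carrier K. chi (h t) * chi ((a \<oplus> a) \<otimes> t \<otimes> y))"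
    proof (rule sum.cong)
      fix t assume t: "t \<in> carrier K"
      have "chi (h y) * cnj (chi (h y)) = 1"
        using norm_chi[OF h[OF y]] by (simp add: complex_norm_square[symmetric])
      then show "chi (h (y \<oplus> t)) * cnj (chi (h y)) = chi (h t) * chi ((a \<oplus> a) \<otimes> t \<otimes> y)"
        using h y t a by (simp add: h_add chi_add mult.commute mult.left_commute)
    qed simp
    finally show ?thesis .
  qed
  have "?G * cnj ?G = (\<Sum>y\<in>carrier K. \<Sum>x\<in>carrier K. chi (h x) * cnj (chi (h y)))"
    by (simp add: cnj_sum sum_product) (rule sum.swap)
  also have "\<dots> = (\<Sum>y\<in>carrier K. \<Sum>t\<in>carrier K. chi (h t) * chi ((a \<oplus> a) \<otimes> t \<otimes> y))"
    by (intro sum.cong refl shift)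
  also have "\<dots> = (\<Sum>t\<in>carrier K. chi (h t) * (\<Sum>y\<in>carrier K. chi ((a \<oplus> a) \<otimes> t \<otimes> y)))"
    by (subst sum.swap) (simp add: sum_distrib_left)
  also have "\<dots> = (\<Sum>t\<in>carrier K. if t = \<zero> then of_nat q else 0)"
  proof (rule sum.cong)
    fix t assume t: "t \<in> carrier K"
    \<comment> \<open>Odd characteristic enters here: 2a is nonzero, so the inner sum over y
      vanishes unless t = 0.\<close>
    have "(a \<oplus> a) \<otimes> t = \<zero> \<longleftrightarrow> t = \<zero>"
      using t a double_nonzero[OF a] by (simp add: integral_iff)
    moreover have "h \<zero> = \<zero>" using a b by (simp add: h_def numeral_2_eq_2)
    ultimately show "chi (h t) * (\<Sum>y\<in>carrier K. chi ((a \<oplus> a) \<otimes> t \<otimes> y))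
        = (if t = \<zero> then of_nat q else 0)"
      using t a by (simp add: sum_chi_mult chi_zero)
  qed simp
  also have "\<dots> = of_nat q" using finite_carrier by simp
  finally have "complex_of_real ((norm ?G)\<^sup>2) = of_nat q"
    by (simp only: complex_norm_square)
  then have "(norm ?G)\<^sup>2 = real q"
    by (metis of_real_eq_iff of_real_of_nat_eq)
  then show ?thesis
    by (simp add: h_def real_sqrt_unique)
qed

section \<open>The paraboloid\<close>

lemma finsum_halves:
  fixes k :: nat
  assumes "g \<in> {1..2 * k} \<rightarrow> carrier K"
  shows "finsum K g {1..2 * k} = (\<Oplus>i\<in>{1..k}. g i \<oplus> g (i + k))"
proof -
  have img: "(\<lambda>i. i + k) ` {1..k} = {k + 1..2 * k}"
    unfolding image_add_atLeastAtMost' by (simp add: mult_2)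
  have "finsum K g {1..2 * k} = finsum K g ({1..k} \<union> (\<lambda>i. i + k) ` {1..k})"
    unfolding img by (rule arg_cong[where f = "finsum K g"]) auto
  also have "\<dots> = finsum K g {1..k} \<oplus> finsum K g ((\<lambda>i. i + k) ` {1..k})"
    using assms by (intro finsum_Un_disjoint) (auto simp: Pi_def)
  also have "finsum K g ((\<lambda>i. i + k) ` {1..k}) = (\<Oplus>i\<in>{1..k}. g (i + k))"
    using assms by (intro finsum_reindex) (auto simp: inj_on_def Pi_def)
  also have "finsum K g {1..k} \<oplus> \<dots> = (\<Oplus>i\<in>{1..k}. g i \<oplus> g (i + k))"
    using assms by (intro finsum_addf[symmetric]) (auto simp: Pi_def)
  finally show ?thesis .
qed

lemma finsum_zero_halves:
  fixes k n :: nat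
  assumes "2 * k \<le> n" "g \<in> {1..n} \<rightarrow> carrier K"
    and "\<And>i. i \<in> {1..k} \<Longrightarrow> g i \<oplus> g (i + k) = \<zero>"
    and "\<And>i. i \<in> {2 * k<..n} \<Longrightarrow> g i = \<zero>"
  shows "finsum K g {1..n} = \<zero>"
proof -
  have "finsum K g {1..n} = finsum K g {1..2 * k}"
    using assms by (intro add.finprod_mono_neutral_cong_right) auto
  also have "\<dots> = (\<Oplus>i\<in>{1..k}. g i \<oplus> g (i + k))"
    using assms by (intro finsum_halves) auto
  also have "\<dots> = \<zero>"
    using assms(3) by (rule add.finprod_one_eqI)
  finally show ?thesis .
qed

text \<open>Halve twice: the first halving of 4k indices pairs \<open>i\<close> with
  \<open>i + 2 * k\<close>, the second pairs the results at \<open>i\<close> and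
  \<open>i + k\<close>. This fixes the order of the four terms in the hypothesis.\<close>

lemma finsum_zero_quarters:
  fixes k n :: nat
  assumes "4 * k \<le> n" "g \<in> {1..n} \<rightarrow> carrier K"
    and "\<And>i. i \<in> {1..k} \<Longrightarrow>
      (g i \<oplus> g (i + 2 * k)) \<oplus> (g (i + k) \<oplus> g (i + 3 * k)) = \<zero>"
    and "\<And>i. i \<in> {4 * k<..n} \<Longrightarrow> g i = \<zero>"
  shows "finsum K g {1..n} = \<zero>"
proof -
  have "finsum K g {1..n} = finsum K g {1..2 * (2 * k)}"
    using assms(1,2,4) by (intro add.finprod_mono_neutral_cong_right) auto
  also have "\<dots> = (\<Oplus>i\<in>{1..2 * k}. g i \<oplus> g (i + 2 * k))"
    using assms(1,2) by (intro finsum_halves) auto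
  also have "\<dots> = \<zero>"
  proof (rule finsum_zero_halves[of k])
    have eq: "i + k + 2 * k = i + 3 * k" for i by simp
    show "(g i \<oplus> g (i + 2 * k)) \<oplus> (g (i + k) \<oplus> g (i + k + 2 * k)) = \<zero>"
      if "i \<in> {1..k}" for i
      using assms(3)[OF that] by (simp only: eq)
  qed (use assms(1,2) in \<open>auto simp: Pi_def\<close>)
  finally show ?thesis .
qed

section \<open>The paraboloid as a graph, and its exponential sums\<close>

lemma finite_vecs: "finite (vecs K d)"
  and card_vecs: "card (vecs K d) = q ^ d"
  using finite_carrier by (simp_all add: vecs_def finite_PiE card_PiE)

lemma finite_paraboloid: "finite (paraboloid K d)"
  using finite_vecs by (simp add: paraboloid_def)

lemma dot_closed: "m \<in> vecs K d \<Longrightarrow> x \<in> vecs K d \<Longrightarrow> dot K d m x \<in> carrier K"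
  unfolding dot_def by (intro finsum_closed) (auto simp: vecs_def PiE_def Pi_def)

text \<open>Parametrizing the paraboloid by its first d - 1 coordinates turns sums over it into sums
  over a full product set, where they can factor.\<close>

definition graph_point :: "nat \<Rightarrow> (nat \<Rightarrow> 'a) \<Rightarrow> nat \<Rightarrow> 'a" where
  "graph_point d x = x(d := \<Oplus>i\<in>{1..d - 1}. x i [^] (2::nat))"

lemma bij_betw_graph_point:
  assumes "1 \<le> d"
  shows "bij_betw (graph_point d) ({1..d - 1} \<rightarrow>\<^sub>E carrier K) (paraboloid K d)"
\<comment> \<open>The inverse erases coordinate \<open>d\<close>; \<open>undefined\<close> is the
  value there of an extensional function on \<open>{1..d - 1}\<close>.\<close>
proof (rule bij_betw_byWitness[where f' = "\<lambda>\<xi>. \<xi>(d := undefined)"])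
  have cong: "(\<Oplus>i\<in>{1..d - 1}. (x(d := c)) i [^] (2::nat)) = (\<Oplus>i\<in>{1..d - 1}. x i [^] (2::nat))"
    if "x \<in> {1..d - 1} \<rightarrow> carrier K" for x c
    using assms that by (intro add.finprod_cong') (auto simp: Pi_def)
  show "\<forall>x\<in>{1..d - 1} \<rightarrow>\<^sub>E carrier K. (graph_point d x)(d := undefined) = x"
    using assms by (auto simp: graph_point_def fun_eq_iff PiE_def extensional_def)
  show "\<forall>\<xi>\<in>paraboloid K d. graph_point d (\<xi>(d := undefined)) = \<xi>"
  proof
    fix \<xi> assume \<xi>: "\<xi> \<in> paraboloid K d"
    then have "\<xi> \<in> {1..d - 1} \<rightarrow> carrier K" by (auto simp: paraboloid_def vecs_def PiE_def Pi_def)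
    from cong[OF this] \<xi> show "graph_point d (\<xi>(d := undefined)) = \<xi>"
      by (simp add: graph_point_def paraboloid_def fun_upd_idem_iff)
  qed
  show "graph_point d ` ({1..d - 1} \<rightarrow>\<^sub>E carrier K) \<subseteq> paraboloid K d"
  proof (rule image_subsetI)
    fix x assume x: "x \<in> {1..d - 1} \<rightarrow>\<^sub>E carrier K"
    then have "x \<in> {1..d - 1} \<rightarrow> carrier K" by auto
    moreover from this have "(\<Oplus>i\<in>{1..d - 1}. x i [^] (2::nat)) \<in> carrier K"
      by (intro finsum_closed) (auto simp: Pi_def)
    ultimately show "graph_point d x \<in> paraboloid K d"
      using cong x assms
      by (auto simp: graph_point_def paraboloid_def vecs_def PiE_def Pi_def extensional_def)
  qed
  show "(\<lambda>\<xi>. \<xi>(d := undefined)) ` paraboloid K d \<subseteq> {1..d - 1} \<rightarrow>\<^sub>E carrier K"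
    using assms by (auto simp: paraboloid_def vecs_def PiE_def Pi_def extensional_def)
qed

lemma card_paraboloid: "1 \<le> d \<Longrightarrow> card (paraboloid K d) = q ^ (d - 1)"
  using bij_betw_same_card[OF bij_betw_graph_point] by (simp add: card_PiE)

lemma paraboloid_nonempty: "1 \<le> d \<Longrightarrow> paraboloid K d \<noteq> {}"
  using card_paraboloid[of d] q_ge_2 by (metis card.empty not_numeral_le_zero power_eq_0_iff)

text \<open>Distributing \<open>m d\<close> over the sum of squares leaves summands that each
  involve a single coordinate of \<open>x\<close>. This separation makes the character sum a
  product.\<close>

lemma dot_graph_point:
  assumes "1 \<le> d" and m: "m \<in> vecs K d" and x: "x \<in> {1..d - 1} \<rightarrow>\<^sub>E carrier K"
  shows "dot K d m (graph_point d x) = (\<Oplus>i\<in>{1..d - 1}. m d \<otimes> x i [^] (2::nat) \<oplus> m i \<otimes> x i)"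
proof -
  have cl: "\<And>i. i \<in> {1..d - 1} \<Longrightarrow> x i \<in> carrier K" "\<And>i. i \<in> {1..d} \<Longrightarrow> m i \<in> carrier K"
    using x m by (auto simp: vecs_def)
  then have cl': "\<And>i. i \<in> {1..d - 1} \<Longrightarrow> m i \<in> carrier K" "m d \<in> carrier K"
    using \<open>1 \<le> d\<close> by auto
  let ?s = "\<Oplus>i\<in>{1..d - 1}. x i [^] (2::nat)"
  have s: "?s \<in> carrier K" using cl by (intro finsum_closed) auto
  have "{1..d} = insert d {1..d - 1}" using \<open>1 \<le> d\<close> by auto
  then have "dot K d m (graph_point d x)
      = (\<Oplus>i\<in>insert d {1..d - 1}. m i \<otimes> graph_point d x i)"
    by (simp add: dot_def)
  also have "\<dots> = m d \<otimes> ?s \<oplus> (\<Oplus>i\<in>{1..d - 1}. m i \<otimes> graph_point d x i)"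
    using cl cl' s \<open>1 \<le> d\<close> by (subst finsum_insert) (auto simp: graph_point_def)
  also have "(\<Oplus>i\<in>{1..d - 1}. m i \<otimes> graph_point d x i) = (\<Oplus>i\<in>{1..d - 1}. m i \<otimes> x i)"
    using cl cl' \<open>1 \<le> d\<close> by (intro add.finprod_cong') (auto simp: graph_point_def)
  also have "m d \<otimes> ?s = (\<Oplus>i\<in>{1..d - 1}. m d \<otimes> x i [^] (2::nat))"
    using cl cl' by (intro finsum_rdistr) auto
  also have "\<dots> \<oplus> (\<Oplus>i\<in>{1..d - 1}. m i \<otimes> x i)
      = (\<Oplus>i\<in>{1..d - 1}. m d \<otimes> x i [^] (2::nat) \<oplus> m i \<otimes> x i)"
    using cl cl' by (intro finsum_addf[symmetric]) auto
  finally show ?thesis .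
qed

text \<open>The sum is a product of d - 1 one-dimensional Gauss sums, all with the nonzero leading
  coefficient \<open>m d\<close>, so each factor has modulus \<open>sqrt q\<close>.\<close>

lemma norm_extension_one:
  assumes "1 \<le> d" "m \<in> vecs K d" "m d \<noteq> \<zero>"
  shows "norm (extension_op K chi d (\<lambda>_. 1) m) = sqrt (real q) ^ (d - 1) / real q ^ (d - 1)"
proof -
  have m: "\<And>i. i \<in> {1..d} \<Longrightarrow> m i \<in> carrier K" "\<And>i. i \<in> {1..d - 1} \<Longrightarrow> m i \<in> carrier K"
      "m d \<in> carrier K"
    using assms by (auto simp: vecs_def)
  have "(\<Sum>\<xi>\<in>paraboloid K d. chi (dot K d m \<xi>))
      = (\<Sum>x\<in>{1..d - 1} \<rightarrow>\<^sub>E carrier K. chi (dot K d m (graph_point d x)))"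
    by (rule sum.reindex_bij_betw[OF bij_betw_graph_point[OF \<open>1 \<le> d\<close>], symmetric])
  also have "\<dots> = (\<Sum>x\<in>{1..d - 1} \<rightarrow>\<^sub>E carrier K.
      \<Prod>i\<in>{1..d - 1}. chi (m d \<otimes> x i [^] (2::nat) \<oplus> m i \<otimes> x i))"
  proof (rule sum.cong)
    fix x assume x: "x \<in> {1..d - 1} \<rightarrow>\<^sub>E carrier K"
    then have "\<And>i. i \<in> {1..d - 1} \<Longrightarrow> x i \<in> carrier K" by auto
    then show "chi (dot K d m (graph_point d x))
        = (\<Prod>i\<in>{1..d - 1}. chi (m d \<otimes> x i [^] (2::nat) \<oplus> m i \<otimes> x i))"
      unfolding dot_graph_point[OF assms(1,2) x] using m by (intro chi_finsum) auto
  qed simp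
  also have "\<dots> = (\<Prod>i\<in>{1..d - 1}. \<Sum>y\<in>carrier K. chi (m d \<otimes> y [^] (2::nat) \<oplus> m i \<otimes> y))"
    using finite_carrier by (intro prod_sum_PiE[symmetric]) auto
  finally have "norm (\<Sum>\<xi>\<in>paraboloid K d. chi (dot K d m \<xi>)) = (\<Prod>i\<in>{1..d - 1}. sqrt (real q))"
    using m assms by (simp add: prod_norm[symmetric] gauss_sum)
  then show ?thesis
    using assms by (simp add: extension_op_def norm_divide card_paraboloid norm_power)
qed

text \<open>Where \<open>m\<close> is orthogonal to \<open>H\<close>, every phase equals 1 and
  nothing cancels.\<close>

lemma extension_op_indicator:
  assumes "1 \<le> d" "m \<in> vecs K d" "\<And>\<xi>. \<xi> \<in> H \<Longrightarrow> dot K d m \<xi> = \<zero>" "H \<subseteq> paraboloid K d"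
  shows "extension_op K chi d (indicator H) m = of_real (card H / card (paraboloid K d))"
proof -
  have "(\<Sum>\<xi>\<in>paraboloid K d. indicator H \<xi> * chi (dot K d m \<xi>)) = (\<Sum>\<xi>\<in>H. 1)"
    using assms finite_paraboloid
    by (intro sum.mono_neutral_cong_right) (auto simp: indicator_def chi_zero)
  then show ?thesis by (simp add: extension_op_def)
qed

text \<open>An average of unimodular multiples of \<open>f\<close> is no larger than the bound on
  \<open>f\<close>. This crude estimate supplies at least one valid constant for
  \<open>extension_const\<close>.\<close>

lemma norm_extension_op_le:
  assumes "1 \<le> d" "m \<in> vecs K d" "\<And>\<xi>. \<xi> \<in> paraboloid K d \<Longrightarrow> norm (f \<xi>) \<le> B"
  shows "norm (extension_op K chi d f m) \<le> B"
proof -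
  let ?P = "paraboloid K d"
  have P: "0 < card ?P"
    using finite_paraboloid paraboloid_nonempty[OF \<open>1 \<le> d\<close>] by (simp add: card_gt_0_iff)
  have "norm (\<Sum>\<xi>\<in>?P. f \<xi> * chi (dot K d m \<xi>)) \<le> (\<Sum>\<xi>\<in>?P. B)"
  proof (rule sum_norm_le)
    fix \<xi> assume "\<xi> \<in> ?P"
    moreover from this have "dot K d m \<xi> \<in> carrier K"
      using assms by (intro dot_closed) (auto simp: paraboloid_def)
    ultimately show "norm (f \<xi> * chi (dot K d m \<xi>)) \<le> B"
      using assms(3) by (simp add: norm_mult norm_chi)
  qed
  then show ?thesis
    using P by (simp add: extension_op_def norm_divide norm_mult field_simps)
qed

section \<open>Test functions\<close>

text \<open>The \<open>LEAST\<close> in the definition of \<open>extension_const\<close> is attained.\<close>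

lemma extension_const_bound:
  assumes d: "1 \<le> d" and pr: "1 \<le> p" "1 \<le> r" and C: "extension_const K chi d p r \<le> C"
  shows "counting_norm K d r (extension_op K chi d f) \<le> C * surface_norm K d p f"
proof -
  let ?P = "paraboloid K d" and ?V = "vecs K d"
  let ?N = "\<lambda>f. counting_norm K d r (extension_op K chi d f)" and ?S = "surface_norm K d p"
  have P: "finite ?P" "?P \<noteq> {}" "0 < card ?P"
    using finite_paraboloid paraboloid_nonempty[OF d] by (auto simp: card_gt_0_iff)
  have V: "0 < card ?V" using q_ge_2 by (simp add: card_vecs)
  then have "?V \<noteq> {}" by auto
  have S_nonneg: "0 \<le> ?S f" for f
    using P Lp_norm_ge[of ?P ?P "1 / card ?P" p 0 f] pr by (simp add: surface_norm_def)
  define W where "W = {C. 0 < C \<and> (\<forall>f. ?N f \<le> C * ?S f)}"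
  define a b where "a = enn2real (1 / p)" and "b = enn2real (1 / r)"
  \<comment> \<open>The maximum of |f| bounds the transform at each of the \<open>card ?V\<close>
    points, and is itself bounded through a single point of mass \<open>1 / card ?P\<close>.
    Multiplying the two losses gives \<open>C0\<close>.\<close>
  define C0 where "C0 = real (card ?V) powr b / (1 / real (card ?P)) powr a"
  have "?N f \<le> C0 * ?S f" for f
  proof -
    define B where "B = Max ((\<lambda>x. norm (f x)) ` ?P)"
    have "B \<in> (\<lambda>x. norm (f x)) ` ?P" unfolding B_def using P by (intro Max_in) auto
    then obtain x where x: "x \<in> ?P" "B = norm (f x)" by blast
    have norm_le: "norm (f \<xi>) \<le> B" if "\<xi> \<in> ?P" for \<xi>
      unfolding B_def using P that by (intro Max_ge) auto
    have "0 \<le> B" using x(2) by simp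
    have "?N f \<le> (1 * real (card ?V)) powr b * B"
      unfolding counting_norm_def b_def
      using finite_vecs \<open>?V \<noteq> {}\<close> pr d norm_le \<open>0 \<le> B\<close>
      by (intro Lp_norm_le norm_extension_op_le) auto
    then have "?N f \<le> real (card ?V) powr b * B" by simp
    also have "B \<le> ?S f / (1 / real (card ?P)) powr a"
    proof -
      have "(1 / real (card ?P) * real (card {x})) powr a * B \<le> ?S f"
        unfolding surface_norm_def a_def using P x pr by (intro Lp_norm_ge) auto
      then show ?thesis using P by (simp add: pos_le_divide_eq mult.commute)
    qed
    finally show ?thesis by (simp add: C0_def mult_left_mono)
  qed
  moreover have "0 < C0" using P V by (simp add: C0_def)
  ultimately have "C0 \<in> W" by (simp add: W_def)
  \<comment> \<open>Testing with f = 1 at m = 0 shows that no valid constant is below 1. Hence the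
    infimum stays positive and can itself lie in \<open>W\<close>.\<close>
  have W_ge_1: "1 \<le> c" if "c \<in> W" for c
  proof -
    define m where "m = (\<lambda>i\<in>{1..d}. \<zero>)"
    have m: "m \<in> ?V" by (auto simp: m_def vecs_def)
    have "dot K d m \<xi> = \<zero>" if "\<xi> \<in> ?P" for \<xi>
      unfolding dot_def using that
      by (intro add.finprod_one_eqI) (auto simp: m_def paraboloid_def vecs_def PiE_def Pi_def)
    then have "(\<Sum>\<xi>\<in>?P. chi (dot K d m \<xi>)) = of_nat (card ?P)"
      by (simp add: chi_zero)
    then have "extension_op K chi d (\<lambda>_. 1) m = 1"
      using P by (simp add: extension_op_def)
    then have "(1 * real (card {m})) powr enn2real (1 / r) * 1 \<le> ?N (\<lambda>_. 1)"
      unfolding counting_norm_def using m finite_vecs pr by (intro Lp_norm_ge) auto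
    also have "\<dots> \<le> c * ?S (\<lambda>_. 1)" using that by (simp add: W_def)
    also have "?S (\<lambda>_. 1) \<le> (1 / real (card ?P) * real (card ?P)) powr enn2real (1 / p) * 1"
      unfolding surface_norm_def using P pr by (intro Lp_norm_le) auto
    then have "c * ?S (\<lambda>_. 1) \<le> c * 1"
      using that P by (intro mult_left_mono) (auto simp: W_def)
    finally show ?thesis by simp
  qed
  have "bdd_below W" using W_ge_1 by (intro bdd_belowI[of _ 1])
  have "?N f \<le> Inf W * ?S f" for f
  \<comment> \<open>The inequality passes to the infimum after division by \<open>?S f\<close>. When
    that norm is 0, the constant is irrelevant and \<open>C0\<close> already gives the
    claim.\<close>
  proof (cases "?S f = 0")
    case True
    have "?N f \<le> C0 * ?S f" using \<open>C0 \<in> W\<close> unfolding W_def by blast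
    then show ?thesis using True by simp
  next
    case False
    then have "0 < ?S f" using S_nonneg[of f] by simp
    then have "?N f / ?S f \<le> Inf W"
      using \<open>C0 \<in> W\<close> by (intro cInf_greatest) (auto simp: W_def pos_divide_le_eq)
    then show ?thesis using \<open>0 < ?S f\<close> by (simp add: pos_divide_le_eq)
  qed
  moreover have "1 \<le> Inf W" using \<open>C0 \<in> W\<close> W_ge_1 by (intro cInf_greatest) auto
  ultimately have Inf_mem: "Inf W \<in> W" by (auto simp: W_def)
  have "extension_const K chi d p r = (LEAST C. C \<in> W)"
    by (simp add: extension_const_def W_def)
  also have "\<dots> = Inf W"
    using Inf_mem \<open>bdd_below W\<close> by (intro Least_equality cInf_lower)
  finally have "Inf W \<le> C" using C by simp
  then have "Inf W * ?S f \<le> C * ?S f" using S_nonneg by (rule mult_right_mono)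
  moreover have "?N f \<le> Inf W * ?S f" using Inf_mem unfolding W_def by blast
  ultimately show ?thesis by linarith
qed

text \<open>Excluding 0 in one coordinate leaves \<open>(q - 1) * q ^ (d - 1)\<close> vectors, and
  \<open>q - 1\<close> is at least \<open>q / 2\<close>.\<close>

lemma card_nonvertical: "1 \<le> d \<Longrightarrow> real q powr real d / 2 \<le> card {m \<in> vecs K d. m d \<noteq> \<zero>}"
proof -
  assume d: "1 \<le> d"
  have "{m \<in> vecs K d. m d \<noteq> \<zero>}
      = (\<Pi>\<^sub>E i\<in>{1..d}. if i = d then carrier K - {\<zero>} else carrier K)"
    using d by (auto simp: vecs_def PiE_def Pi_def)
  moreover have "{1..d} = insert d {1..d - 1}" using d by auto
  ultimately have "card {m \<in> vecs K d. m d \<noteq> \<zero>}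
      = (\<Prod>i\<in>insert d {1..d - 1}. card (if i = d then carrier K - {\<zero>} else carrier K))"
    by (simp add: card_PiE)
  also have "\<dots> = (q - 1) * (\<Prod>i\<in>{1..d - 1}. card (if i = d then carrier K - {\<zero>} else carrier K))"
    using d finite_carrier by (subst prod.insert) auto
  also have "(\<Prod>i\<in>{1..d - 1}. card (if i = d then carrier K - {\<zero>} else carrier K))
      = (\<Prod>i\<in>{1..d - 1}. q)"
  proof (rule prod.cong[OF refl])
    fix i assume "i \<in> {1..d - 1}"
    then have "i \<noteq> d" using d by auto
    then show "card (if i = d then carrier K - {\<zero>} else carrier K) = q" by simp
  qed
  finally have card: "card {m \<in> vecs K d. m d \<noteq> \<zero>} = (q - 1) * q ^ (d - 1)" by simp
  have "real q powr real d = real q ^ d" using q_ge_2 by (intro powr_realpow) simp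
  also have "\<dots> = real q * real q ^ (d - 1)"
    using d by (metis power_minus_mult mult.commute zero_less_one less_le_trans)
  finally have "real q powr real d = real q * real q ^ (d - 1)" .
  moreover have "real q / 2 * real q ^ (d - 1) \<le> real (q - 1) * real q ^ (d - 1)"
    using q_ge_2 by (intro mult_right_mono) auto
  ultimately show ?thesis by (simp add: card)
qed

text \<open>The factor 2 in the bound compensates for the half in \<open>card_nonvertical\<close>:
  it is raised to the power \<open>1 / r\<close>, which is at most 1.\<close>

lemma test_constant:
  assumes d: "1 \<le> d" and pr: "1 \<le> p" "1 \<le> r" and C: "extension_const K chi d p r \<le> C"
  shows "real q powr (real d * enn2real (1 / r) - (real d - 1) / 2) \<le> 2 * C"
proof -
  let ?P = "paraboloid K d" and ?M = "{m \<in> vecs K d. m d \<noteq> \<zero>}" and ?Q = "real q"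
  define b where "b = enn2real (1 / r)"
  have b: "0 \<le> b" "b \<le> 1" using exponent_bounds[OF pr(2)] by (simp_all add: b_def)
  have Q: "2 \<le> ?Q" using q_ge_2 by simp
  have P: "finite ?P" "?P \<noteq> {}" "0 < card ?P"
    using finite_paraboloid paraboloid_nonempty[OF d] by (auto simp: card_gt_0_iff)
  have M: "?Q powr real d / 2 \<le> real (card ?M)" by (rule card_nonvertical[OF d])
  moreover have "0 < ?Q powr real d" using Q by simp
  ultimately have "0 < card ?M" by linarith
  then have "?M \<noteq> {}" by force
  define c where "c = sqrt ?Q ^ (d - 1) / ?Q ^ (d - 1)"
  have "sqrt ?Q ^ (d - 1) = ?Q powr (1 / 2 * (real d - 1))"
    using Q d by (simp add: powr_half_sqrt[symmetric] powr_realpow[symmetric] powr_powr of_nat_diff)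
  moreover have "?Q ^ (d - 1) = ?Q powr (real d - 1)"
    using Q d by (simp add: powr_realpow[symmetric] of_nat_diff)
  ultimately have "c = ?Q powr (1 / 2 * (real d - 1) - (real d - 1))"
    by (simp add: c_def powr_diff)
  also have "1 / 2 * (real d - 1) - (real d - 1) = - (real d - 1) / 2"
    by (simp add: field_simps)
  finally have c: "c = ?Q powr (- (real d - 1) / 2)" .
  have "real d * b - (real d - 1) / 2 = real d * b + - (real d - 1) / 2"
    by (simp add: field_simps)
  then have "?Q powr (real d * b - (real d - 1) / 2) = (?Q powr real d) powr b * c"
    by (simp only: c powr_powr powr_add)
  also have "(?Q powr real d) powr b = 2 powr b * (?Q powr real d / 2) powr b"
    using Q by (simp add: powr_mult[symmetric])
  also have "\<dots> * c \<le> 2 powr 1 * real (card ?M) powr b * c"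
    using M b by (intro mult_right_mono mult_mono powr_mono2 powr_mono) (auto simp: c)
  also have "\<dots> = 2 * ((1 * real (card ?M)) powr b * c)" by simp
  also have "(1 * real (card ?M)) powr b * c \<le> counting_norm K d r (extension_op K chi d (\<lambda>_. 1))"
    unfolding counting_norm_def b_def
    using finite_vecs \<open>?M \<noteq> {}\<close> pr d
    by (intro Lp_norm_ge) (auto simp: c_def norm_extension_one)
  also have "\<dots> \<le> C * surface_norm K d p (\<lambda>_. 1)"
    by (rule extension_const_bound[OF d pr C])
  also have "surface_norm K d p (\<lambda>_. 1) = 1"
  proof (rule antisym)
    show "surface_norm K d p (\<lambda>_. 1) \<le> 1"
      using P pr Lp_norm_le[of ?P ?P "1 / real (card ?P)" p 1 "\<lambda>_. 1"]
      by (simp add: surface_norm_def)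
    show "1 \<le> surface_norm K d p (\<lambda>_. 1)"
      using P pr Lp_norm_ge[of ?P ?P "1 / real (card ?P)" p 1 "\<lambda>_. 1"]
      by (simp add: surface_norm_def)
  qed
  finally show ?thesis by (simp add: b_def)
qed

text \<open>With \<open>h = |H| / |P|\<close>, the transform is \<open>h\<close> on \<open>M\<close>
  while the indicator has norm \<open>h powr (1 / p)\<close>. Dividing leaves
  \<open>|M| powr (1 / r) * h powr (1 - 1 / p)\<close>, whose exponents are nonnegative, so lower
  bounds for \<open>|H|\<close> and \<open>|M|\<close> suffice.\<close>

lemma test_indicator:
  assumes d: "1 \<le> d" and pr: "1 \<le> p" "1 \<le> r" and C: "extension_const K chi d p r \<le> C"
    and k: "k \<le> d - 1"
    and H: "H \<subseteq> paraboloid K d" "q ^ k \<le> card H"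
    and M: "M \<subseteq> vecs K d" "q ^ (d - k) \<le> card M"
    and dot: "\<And>m \<xi>. m \<in> M \<Longrightarrow> \<xi> \<in> H \<Longrightarrow> dot K d m \<xi> = \<zero>"
  shows "real q powr ((real d - real k) * enn2real (1 / r)
      - (real d - 1 - real k) * (1 - enn2real (1 / p))) \<le> C"
proof -
  let ?P = "paraboloid K d" and ?Q = "real q"
  define a b where "a = enn2real (1 / p)" and "b = enn2real (1 / r)"
  have ab: "0 \<le> a" "a \<le> 1" "0 \<le> b"
    using exponent_bounds[OF pr(1)] exponent_bounds[OF pr(2)] by (simp_all add: a_def b_def)
  have Q: "2 \<le> ?Q" using q_ge_2 by simp
  have P: "finite ?P" "?P \<noteq> {}" "0 < card ?P"
    using finite_paraboloid paraboloid_nonempty[OF d] by (auto simp: card_gt_0_iff)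
  have "0 < q ^ k" "0 < q ^ (d - k)" using q_ge_2 by simp_all
  then have pos: "0 < card H" "0 < card M" using H M by linarith+
  then have ne: "H \<noteq> {}" "M \<noteq> {}" by auto
  define h where "h = real (card H) / real (card ?P)"
  have "0 < h" using pos P by (simp add: h_def)
  have "- (real d - 1 - real k) = real k - real (d - 1)" using d by simp
  moreover have "?Q powr real k = ?Q ^ k" "?Q powr real (d - 1) = ?Q ^ (d - 1)"
    using Q by (auto intro: powr_realpow)
  ultimately have "?Q powr (- (real d - 1 - real k)) = ?Q ^ k / ?Q ^ (d - 1)"
    by (simp only: powr_diff)
  also have "\<dots> \<le> h"
  proof -
    have "?Q ^ k \<le> real (card H)" using H(2) by (metis of_nat_le_iff of_nat_power)
    then show ?thesis unfolding h_def card_paraboloid[OF d] of_nat_power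
      by (intro divide_right_mono) auto
  qed
  finally have h: "?Q powr (- (real d - 1 - real k)) \<le> h" .
  have "real d - real k = real (d - k)" using k by simp
  moreover have "?Q powr real (d - k) = ?Q ^ (d - k)" using Q by (intro powr_realpow) simp
  moreover have "?Q ^ (d - k) \<le> real (card M)" using M(2) by (metis of_nat_le_iff of_nat_power)
  ultimately have m: "?Q powr (real d - real k) \<le> real (card M)" by (simp only:)
  have "real (card M) powr b * h \<le> counting_norm K d r (extension_op K chi d (indicator H))"
  proof -
    have "h \<le> norm (extension_op K chi d (indicator H) m)" if "m \<in> M" for m
      using that M(1) H(1) d dot \<open>0 < h\<close>
      by (subst extension_op_indicator) (auto simp: h_def norm_divide)
    then have "(1 * real (card M)) powr b * h \<le> Lp_norm 1 (vecs K d) r (extension_op K chi d (indicator H))"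
      unfolding b_def using finite_vecs M(1) ne pr \<open>0 < h\<close> by (intro Lp_norm_ge) auto
    then show ?thesis by (simp add: counting_norm_def)
  qed
  also have "\<dots> \<le> C * surface_norm K d p (indicator H)"
    by (rule extension_const_bound[OF d pr C])
  also have "surface_norm K d p (indicator H) = h powr a"
  proof (rule antisym)
    show "surface_norm K d p (indicator H) \<le> h powr a"
      using P pr H(1) ne Lp_norm_le[of ?P H "1 / real (card ?P)" p 1 "indicator H"]
      by (simp add: surface_norm_def h_def a_def)
    show "h powr a \<le> surface_norm K d p (indicator H)"
      using P pr H(1) ne Lp_norm_ge[of ?P H "1 / real (card ?P)" p 1 "indicator H"]
      by (simp add: surface_norm_def h_def a_def)
  qed
  finally have "real (card M) powr b * h / h powr a \<le> C"
    using \<open>0 < h\<close> by (simp add: pos_divide_le_eq)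
  moreover have "h / h powr a = h powr (1 - a)"
    using \<open>0 < h\<close> by (simp add: powr_diff)
  ultimately have *: "real (card M) powr b * h powr (1 - a) \<le> C"
    by (metis times_divide_eq_right)
  have "?Q powr ((real d - real k) * b - (real d - 1 - real k) * (1 - a))
      = (?Q powr (real d - real k)) powr b * (?Q powr (- (real d - 1 - real k))) powr (1 - a)"
    by (simp only: powr_powr powr_add[symmetric]) (simp add: algebra_simps)
  also have "\<dots> \<le> real (card M) powr b * h powr (1 - a)"
    using m h ab by (intro mult_mono powr_mono2) auto
  also note *
  finally show ?thesis by (simp add: a_def b_def)
qed

end

section \<open>Subspaces of the paraboloid\<close>

text \<open>
  For \<open>K\<close> with \<open>q\<close> elements, \<open>H\<close> plays the role of a \<open>k\<close>-dimensional subspace in the paraboloid and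
  \<open>M\<close> that of its orthogonal complement; only lower bounds on their sizes are needed.
\<close>

definition flat_pair :: "'a ring \<Rightarrow> nat \<Rightarrow> nat \<Rightarrow> bool" where
  "flat_pair K d k \<longleftrightarrow>
     (\<exists>H M. H \<subseteq> paraboloid K d \<and> card (carrier K) ^ k \<le> card H \<and>
        M \<subseteq> vecs K d \<and> card (carrier K) ^ (d - k) \<le> card M \<and>
        (\<forall>m\<in>M. \<forall>\<xi>\<in>H. dot K d m \<xi> = \<zero>\<^bsub>K\<^esub>))"

context character_field
begin

text \<open>Restriction to \<open>I\<close> maps \<open>S\<close> onto all assignments of the
  coordinates in \<open>I\<close>. This replaces a dimension count.\<close>

lemma power_le_card_free_coordinates:
  assumes "finite S" "finite I"
    and extend: "\<And>y. y \<in> I \<rightarrow>\<^sub>E carrier K \<Longrightarrow> \<exists>s\<in>S. \<forall>i\<in>I. s i = y i"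
  shows "q ^ card I \<le> card S"
proof -
  have "I \<rightarrow>\<^sub>E carrier K \<subseteq> (\<lambda>s. restrict s I) ` S"
  proof
    fix y assume y: "y \<in> I \<rightarrow>\<^sub>E carrier K"
    then obtain s where s: "s \<in> S" "\<forall>i\<in>I. s i = y i" using extend by blast
    then have "y = restrict s I" using y by (auto simp: PiE_def extensional_def fun_eq_iff)
    then show "y \<in> (\<lambda>s. restrict s I) ` S" using s(1) by blast
  qed
  then have "card (I \<rightarrow>\<^sub>E carrier K) \<le> card S"
    using \<open>finite S\<close> by (meson card_image_le card_mono finite_imageI order.trans)
  then show ?thesis using \<open>finite I\<close> by (simp add: card_PiE)
qed

text \<open>With last coordinate 0, the paraboloid equation says that the sum of squares vanishes.
  The sizes follow because the first k coordinates are free in \<open>H\<close> and the last d - k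
  are free in \<open>M\<close>.\<close>

lemma flat_pairI:
  assumes H: "H \<subseteq> vecs K d" and M: "M \<subseteq> vecs K d" and k: "k \<le> d"
    and graph: "\<And>\<xi>. \<xi> \<in> H \<Longrightarrow> \<xi> d = \<zero>"
      "\<And>\<xi>. \<xi> \<in> H \<Longrightarrow> (\<Oplus>i\<in>{1..d - 1}. \<xi> i [^] (2::nat)) = \<zero>"
    and dot: "\<And>m \<xi>. m \<in> M \<Longrightarrow> \<xi> \<in> H \<Longrightarrow> (\<Oplus>i\<in>{1..d}. m i \<otimes> \<xi> i) = \<zero>"
    and extend_H: "\<And>y. y \<in> {1..k} \<rightarrow>\<^sub>E carrier K \<Longrightarrow> \<exists>\<xi>\<in>H. \<forall>i\<in>{1..k}. \<xi> i = y i"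
    and extend_M: "\<And>y. y \<in> {k + 1..d} \<rightarrow>\<^sub>E carrier K \<Longrightarrow> \<exists>m\<in>M. \<forall>i\<in>{k + 1..d}. m i = y i"
  shows "flat_pair K d k"
  unfolding flat_pair_def
proof (rule exI[of _ H], rule exI[of _ M], intro conjI ballI)
  show "H \<subseteq> paraboloid K d" using H graph by (auto simp: paraboloid_def)
  have "finite H" "finite M" using H M finite_vecs finite_subset by blast+
  then show "q ^ k \<le> card H" "q ^ (d - k) \<le> card M"
    using power_le_card_free_coordinates[of H "{1..k}"] extend_H
      power_le_card_free_coordinates[of M "{k + 1..d}"] extend_M by auto
  show "dot K d m \<xi> = \<zero>" if "m \<in> M" "\<xi> \<in> H" for m \<xi>
    using dot that by (simp add: dot_def)
qed (rule M)

text \<open>With \<open>j\<^sup>2 = -1\<close>, the points \<open>(x, j x, 0)\<close> with \<open>x \<in> K\<^sup>k\<close> lie on the paraboloid.\<close>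

lemma flat_pair_of_sqrt_minus_one:
  assumes "minus_one_is_square K" and k: "2 * k < d"
  shows "flat_pair K d k"
proof -
  obtain j where j: "j \<in> carrier K" "j [^] (2::nat) = \<ominus> \<one>"
    using assms(1) by (auto simp: minus_one_is_square_def)
  define H where "H = {\<xi> \<in> vecs K d. (\<forall>i\<in>{1..k}. \<xi> (i + k) = j \<otimes> \<xi> i) \<and> (\<forall>i\<in>{2 * k<..d}. \<xi> i = \<zero>)}"
  \<comment> \<open>The product of \<open>m\<close> with a point of \<open>H\<close> is the sum over
    i up to k of \<open>(m i + j * m (i + k)) * \<xi> i\<close>; each coefficient is made to vanish
    by solving for \<open>m i\<close>.\<close>
  define M where "M = {m \<in> vecs K d. \<forall>i\<in>{1..k}. m i = \<ominus> (j \<otimes> m (i + k))}"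
  have cl: "x i \<in> carrier K" if "x \<in> H \<or> x \<in> M" "i \<in> {1..d}" for x i
    using that by (auto simp: H_def M_def vecs_def)
  show ?thesis
  proof (rule flat_pairI)
    show "H \<subseteq> vecs K d" "M \<subseteq> vecs K d" "k \<le> d" using k by (auto simp: H_def M_def)
    show "\<xi> d = \<zero>" if "\<xi> \<in> H" for \<xi> using that k by (auto simp: H_def)
    show "(\<Oplus>i\<in>{1..d - 1}. \<xi> i [^] (2::nat)) = \<zero>" if \<xi>: "\<xi> \<in> H" for \<xi>
    proof (rule finsum_zero_halves)
      show "2 * k \<le> d - 1" using k by simp
      show "(\<lambda>i. \<xi> i [^] (2::nat)) \<in> {1..d - 1} \<rightarrow> carrier K" using cl[of \<xi>] \<xi> by auto
      show "\<xi> i [^] (2::nat) = \<zero>" if "i \<in> {2 * k<..d - 1}" for i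
        using that \<xi> by (auto simp: H_def numeral_2_eq_2)
      show "\<xi> i [^] (2::nat) \<oplus> \<xi> (i + k) [^] (2::nat) = \<zero>" if "i \<in> {1..k}" for i
      proof -
        have x: "\<xi> i \<in> carrier K" using cl[of \<xi> i] \<xi> that k by auto
        have "\<xi> (i + k) [^] (2::nat) = \<ominus> (\<xi> i [^] (2::nat))"
          using \<xi> that x j by (simp add: H_def nat_pow_distrib l_minus)
        then show ?thesis using x by (simp add: r_neg)
      qed
    qed
    show "(\<Oplus>i\<in>{1..d}. m i \<otimes> \<xi> i) = \<zero>" if m: "m \<in> M" and \<xi>: "\<xi> \<in> H" for m \<xi>
    proof (rule finsum_zero_halves)
      show "2 * k \<le> d" using k by simp
      show "(\<lambda>i. m i \<otimes> \<xi> i) \<in> {1..d} \<rightarrow> carrier K" using cl[of \<xi>] cl[of m] \<xi> m by auto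
      show "m i \<otimes> \<xi> i = \<zero>" if "i \<in> {2 * k<..d}" for i
        using that \<xi> cl[of m i] m by (auto simp: H_def)
      show "m i \<otimes> \<xi> i \<oplus> m (i + k) \<otimes> \<xi> (i + k) = \<zero>" if "i \<in> {1..k}" for i
      proof -
        have x: "\<xi> i \<in> carrier K" "m (i + k) \<in> carrier K"
          using cl[of \<xi> i] cl[of m "i + k"] \<xi> m that k by auto
        have "m i = \<ominus> (j \<otimes> m (i + k))" "\<xi> (i + k) = j \<otimes> \<xi> i"
          using m \<xi> that by (auto simp: M_def H_def)
        then have "m i \<otimes> \<xi> i = \<ominus> (m (i + k) \<otimes> \<xi> (i + k))"
          using x j by (simp add: l_minus r_minus m_ac)
        then show ?thesis using x j \<open>\<xi> (i + k) = j \<otimes> \<xi> i\<close> by (simp add: l_neg)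
      qed
    qed
    show "\<exists>\<xi>\<in>H. \<forall>i\<in>{1..k}. \<xi> i = y i" if y: "y \<in> {1..k} \<rightarrow>\<^sub>E carrier K" for y
    proof
      show "(\<lambda>i\<in>{1..d}. if i \<le> k then y i else if i \<le> 2 * k then j \<otimes> y (i - k) else \<zero>) \<in> H"
      proof -
        have "y i \<in> carrier K" if "1 \<le> i" "i \<le> k" for i using y that by auto
        then show ?thesis using k j by (auto simp: H_def vecs_def)
      qed
    qed (use k in auto)
    show "\<exists>m\<in>M. \<forall>i\<in>{k + 1..d}. m i = y i" if y: "y \<in> {k + 1..d} \<rightarrow>\<^sub>E carrier K" for y
    proof
      show "(\<lambda>i\<in>{1..d}. if i \<le> k then \<ominus> (j \<otimes> y (i + k)) else y i) \<in> M"
      proof -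
        have "y i \<in> carrier K" if "k < i" "i \<le> d" for i using y that by auto
        then show ?thesis using k j by (auto simp: M_def vecs_def)
      qed
    qed auto
  qed
qed

text \<open>
  In characteristic 3 the squares of \<open>s\<close>, \<open>t\<close>, \<open>s + t\<close>, \<open>s - t\<close> add up to \<open>3 s\<^sup>2 + 3 t\<^sup>2 = 0\<close>,
  so the points \<open>(x, y, x + y, x - y, 0)\<close> with \<open>x, y \<in> K\<^sup>k\<close> lie on the paraboloid.
\<close>

lemma flat_pair_of_char_three:
  assumes char3: "\<And>x. x \<in> carrier K \<Longrightarrow> x \<oplus> x \<oplus> x = \<zero>" and k: "4 * k < d"
  shows "flat_pair K d (2 * k)"
proof -
  define H where "H = {\<xi> \<in> vecs K d.
    (\<forall>i\<in>{1..k}. \<xi> (i + 2 * k) = \<xi> i \<oplus> \<xi> (i + k) \<and> \<xi> (i + 3 * k) = \<xi> i \<oplus> \<ominus> \<xi> (i + k)) \<and>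
    (\<forall>i\<in>{4 * k<..d}. \<xi> i = \<zero>)}"
  \<comment> \<open>Collecting the terms in x and y gives the coefficients
    \<open>m i + m (i + 2 * k) + m (i + 3 * k)\<close> and
    \<open>m (i + k) + m (i + 2 * k) - m (i + 3 * k)\<close>; both are set to 0.\<close>
  define M where "M = {m \<in> vecs K d.
    \<forall>i\<in>{1..k}. m i = \<ominus> (m (i + 2 * k) \<oplus> m (i + 3 * k)) \<and>
      m (i + k) = m (i + 3 * k) \<oplus> \<ominus> m (i + 2 * k)}"
  have cl: "x i \<in> carrier K" if "x \<in> H \<or> x \<in> M" "i \<in> {1..d}" for x i
    using that by (auto simp: H_def M_def vecs_def)
  have squares: "(s [^] (2::nat) \<oplus> (s \<oplus> t) [^] (2::nat)) \<oplus>
      (t [^] (2::nat) \<oplus> (s \<oplus> \<ominus> t) [^] (2::nat)) = \<zero>"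
    if st: "s \<in> carrier K" "t \<in> carrier K" for s t
  proof -
    \<comment> \<open>Here \<open>u\<close> and \<open>v\<close> stand for the squares of s and t,
      and \<open>w\<close>, \<open>w'\<close> for the cross terms 2st and -2st, which
      cancel.\<close>
    have rearrange: "(u \<oplus> (u \<oplus> w \<oplus> v)) \<oplus> (v \<oplus> (u \<oplus> w' \<oplus> v)) =
        (u \<oplus> u \<oplus> u) \<oplus> (v \<oplus> v \<oplus> v) \<oplus> (w \<oplus> w')"
      if "u \<in> carrier K" "v \<in> carrier K" "w \<in> carrier K" "w' \<in> carrier K" for u v w w'
      using that by (simp add: a_ac)
    have "(\<ominus> t) [^] (2::nat) = t [^] (2::nat)"
      using st by (simp add: numeral_2_eq_2 l_minus r_minus)
    moreover have "s \<otimes> \<ominus> t \<oplus> s \<otimes> \<ominus> t = \<ominus> (s \<otimes> t \<oplus> s \<otimes> t)"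
      using st by (simp add: r_minus minus_add)
    ultimately show ?thesis
      using st by (simp only: square_add rearrange char3 r_neg a_closed m_closed a_inv_closed
          nat_pow_closed r_zero zero_closed)
  qed
  have products: "(\<ominus> (e \<oplus> f) \<otimes> s \<oplus> e \<otimes> (s \<oplus> t)) \<oplus>
      ((f \<oplus> \<ominus> e) \<otimes> t \<oplus> f \<otimes> (s \<oplus> \<ominus> t)) = \<zero>"
    if st: "s \<in> carrier K" "t \<in> carrier K" "e \<in> carrier K" "f \<in> carrier K" for s t e f
  proof -
    \<comment> \<open>Primed letters stand for the negatives of the unprimed products es, et, fs and
      ft, so the regrouping exhibits four cancelling pairs.\<close>
    have rearrange: "((A' \<oplus> C') \<oplus> (A \<oplus> B)) \<oplus> ((D \<oplus> B') \<oplus> (C \<oplus> D')) =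
        (A \<oplus> A') \<oplus> (B \<oplus> B') \<oplus> (C \<oplus> C') \<oplus> (D \<oplus> D')"
      if "A \<in> carrier K" "A' \<in> carrier K" "B \<in> carrier K" "B' \<in> carrier K"
        "C \<in> carrier K" "C' \<in> carrier K" "D \<in> carrier K" "D' \<in> carrier K" for A A' B B' C C' D D'
      using that by (simp add: a_ac)
    have "\<ominus> (e \<oplus> f) \<otimes> s = \<ominus> (e \<otimes> s) \<oplus> \<ominus> (f \<otimes> s)" "e \<otimes> (s \<oplus> t) = e \<otimes> s \<oplus> e \<otimes> t"
      "(f \<oplus> \<ominus> e) \<otimes> t = f \<otimes> t \<oplus> \<ominus> (e \<otimes> t)" "f \<otimes> (s \<oplus> \<ominus> t) = f \<otimes> s \<oplus> \<ominus> (f \<otimes> t)"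
      using st by (simp_all add: l_distr r_distr l_minus r_minus minus_add)
    then show ?thesis
      using st by (simp only: rearrange r_neg m_closed a_inv_closed r_zero zero_closed)
  qed
  show ?thesis
  proof (rule flat_pairI)
    show "H \<subseteq> vecs K d" "M \<subseteq> vecs K d" "2 * k \<le> d" using k by (auto simp: H_def M_def)
    show "\<xi> d = \<zero>" if "\<xi> \<in> H" for \<xi> using that k by (auto simp: H_def)
    show "(\<Oplus>i\<in>{1..d - 1}. \<xi> i [^] (2::nat)) = \<zero>" if \<xi>: "\<xi> \<in> H" for \<xi>
    proof (rule finsum_zero_quarters)
      show "4 * k \<le> d - 1" using k by simp
      show "(\<lambda>i. \<xi> i [^] (2::nat)) \<in> {1..d - 1} \<rightarrow> carrier K" using cl[of \<xi>] \<xi> by auto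
      show "\<xi> i [^] (2::nat) = \<zero>" if "i \<in> {4 * k<..d - 1}" for i
        using that \<xi> by (auto simp: H_def numeral_2_eq_2)
      fix i assume i: "i \<in> {1..k}"
      then have "\<xi> i \<in> carrier K" "\<xi> (i + k) \<in> carrier K" using cl[of \<xi>] \<xi> k by auto
      moreover have "\<xi> (i + 2 * k) = \<xi> i \<oplus> \<xi> (i + k)" "\<xi> (i + 3 * k) = \<xi> i \<oplus> \<ominus> \<xi> (i + k)"
        using \<xi> i by (auto simp: H_def)
      ultimately show "(\<xi> i [^] (2::nat) \<oplus> \<xi> (i + 2 * k) [^] (2::nat)) \<oplus>
          (\<xi> (i + k) [^] (2::nat) \<oplus> \<xi> (i + 3 * k) [^] (2::nat)) = \<zero>"
        by (simp only: squares)
    qed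
    show "(\<Oplus>i\<in>{1..d}. m i \<otimes> \<xi> i) = \<zero>" if m: "m \<in> M" and \<xi>: "\<xi> \<in> H" for m \<xi>
    proof (rule finsum_zero_quarters)
      show "4 * k \<le> d" using k by simp
      show "(\<lambda>i. m i \<otimes> \<xi> i) \<in> {1..d} \<rightarrow> carrier K" using cl[of \<xi>] cl[of m] \<xi> m by auto
      show "m i \<otimes> \<xi> i = \<zero>" if "i \<in> {4 * k<..d}" for i
        using that \<xi> cl[of m i] m by (auto simp: H_def)
      fix i assume i: "i \<in> {1..k}"
      then have "\<xi> i \<in> carrier K" "\<xi> (i + k) \<in> carrier K"
          "m (i + 2 * k) \<in> carrier K" "m (i + 3 * k) \<in> carrier K"
        using cl[of \<xi>] cl[of m] \<xi> m k by auto
      moreover have "\<xi> (i + 2 * k) = \<xi> i \<oplus> \<xi> (i + k)" "\<xi> (i + 3 * k) = \<xi> i \<oplus> \<ominus> \<xi> (i + k)"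
          "m i = \<ominus> (m (i + 2 * k) \<oplus> m (i + 3 * k))"
          "m (i + k) = m (i + 3 * k) \<oplus> \<ominus> m (i + 2 * k)"
        using m \<xi> i unfolding H_def M_def by blast+
      ultimately show "(m i \<otimes> \<xi> i \<oplus> m (i + 2 * k) \<otimes> \<xi> (i + 2 * k)) \<oplus>
          (m (i + k) \<otimes> \<xi> (i + k) \<oplus> m (i + 3 * k) \<otimes> \<xi> (i + 3 * k)) = \<zero>"
        by (simp only: products)
    qed
    show "\<exists>\<xi>\<in>H. \<forall>i\<in>{1..2 * k}. \<xi> i = y i" if y: "y \<in> {1..2 * k} \<rightarrow>\<^sub>E carrier K" for y
    proof
      define \<xi> where "\<xi> = (\<lambda>i\<in>{1..d}. if i \<le> 2 * k then y i
          else if i \<le> 3 * k then y (i - 2 * k) \<oplus> y (i - k)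
          else if i \<le> 4 * k then y (i - 3 * k) \<oplus> \<ominus> y (i - 2 * k) else \<zero>)"
      have y': "y i \<in> carrier K" if "1 \<le> i" "i \<le> 2 * k" for i using y that by auto
      have "\<xi> \<in> vecs K d"
        using k by (auto simp: vecs_def \<xi>_def intro!: a_closed a_inv_closed y')
      moreover have "y (k + i) = y (i + k)" for i by (simp add: add.commute)
      ultimately show "\<xi> \<in> H" using k by (auto simp: H_def \<xi>_def)
      show "\<forall>i\<in>{1..2 * k}. \<xi> i = y i" using k by (simp add: \<xi>_def)
    qed
    show "\<exists>m\<in>M. \<forall>i\<in>{2 * k + 1..d}. m i = y i" if y: "y \<in> {2 * k + 1..d} \<rightarrow>\<^sub>E carrier K" for y
    proof
      define m where "m = (\<lambda>i\<in>{1..d}. if i \<le> k then \<ominus> (y (i + 2 * k) \<oplus> y (i + 3 * k))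
          else if i \<le> 2 * k then y (i + 2 * k) \<oplus> \<ominus> y (i + k) else y i)"
      have y': "y i \<in> carrier K" if "2 * k < i" "i \<le> d" for i using y that by auto
      have "m \<in> vecs K d"
        using k by (auto simp: vecs_def m_def intro!: a_closed a_inv_closed y')
      moreover have "3 * k + i = i + 3 * k" "i + k + k = i + 2 * k" for i by simp_all
      then have "y (3 * k + i) = y (i + 3 * k)" "y (i + k + k) = y (i + 2 * k)" for i by metis+
      ultimately show "m \<in> M" using k by (auto simp: M_def m_def)
      show "\<forall>i\<in>{2 * k + 1..d}. m i = y i" using k by (simp add: m_def)
    qed
  qed
qed

section \<open>Characteristic three, and when -1 is a square\<close>

lemma char_three:
  assumes "q = 3 ^ n" and x: "x \<in> carrier K"
  shows "x \<oplus> x \<oplus> x = \<zero>"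
proof -
  let ?c = "[(3::nat)] \<cdot> \<one>"
  \<comment> \<open>By this identity \<open>q\<close> times the unit is the n-th power of 3 times
    the unit. As it is 0 and a field has no zero divisors, 3 itself vanishes in
    \<open>K\<close>.\<close>
  have pow: "[((3::nat) ^ m)] \<cdot> \<one> = ?c [^] m" for m
  proof (induction m)
    case (Suc m)
    have "[((3::nat) ^ Suc m)] \<cdot> \<one> = [((3::nat) ^ m)] \<cdot> ([(3::nat)] \<cdot> \<one>)"
      by (simp add: add.nat_pow_pow)
    also have "\<dots> = [((3::nat) ^ m)] \<cdot> \<one> \<otimes> ?c" by (simp add: add_pow_ldistr)
    finally show ?case by (simp add: Suc.IH)
  qed simp
  have "?c = \<zero>"
  proof (rule ccontr)
    assume "?c \<noteq> \<zero>"
    then have "?c [^] m \<noteq> \<zero>" for m :: nat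
      by (induction m) (simp_all add: integral_iff)
    moreover have "?c [^] n = \<zero>" using pow[of n] card_add_pow[of \<one>] assms(1) by simp
    ultimately show False by blast
  qed
  moreover have "[(3::nat)] \<cdot> x = ?c \<otimes> x"
    using x by (subst add_pow_ldistr) auto
  ultimately have "[(3::nat)] \<cdot> x = \<zero>" using x by simp
  then show ?thesis using x by (simp add: numeral_3_eq_3)
qed

lemma minus_one_neq_one: "\<ominus> \<one> \<noteq> \<one>"
  using double_nonzero[of \<one>] by (metis l_neg one_closed zero_not_one)

text \<open>The multiplicative group is cyclic of order 4j. For a generator \<open>a\<close>, the
  element \<open>a^(2j)\<close> is a square root of 1 other than 1, hence -1, and \<open>a^j\<close>
  is a square root of it.\<close>

lemma minus_one_is_square_if_dvd:
  assumes "4 dvd q - 1"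
  shows "minus_one_is_square K"
proof -
  obtain j where j: "q - 1 = 4 * j" using assms by (rule dvdE)
  then have "0 < j" using q_ge_2 by simp
  obtain a where a: "a \<in> carrier (Multiplicative_Group.mult_of K)" "carrier (Multiplicative_Group.mult_of K) = range (\<lambda>i::nat. a [^] i)"
    using finite_field_mult_group_has_gen[OF finite_carrier] by (auto simp: full_SetCompr_eq)
  then have aK: "a \<in> carrier K" by simp
  interpret G: group "Multiplicative_Group.mult_of K" by (rule field_mult_group)
  have card_mult: "card (carrier (Multiplicative_Group.mult_of K)) = 4 * j"
    using finite_carrier j by simp
  have a_pow: "a [^] (4 * j) = \<one>"
    using G.pow_order_eq_1[OF a(1)] card_mult by (simp add: Coset.order_def Multiplicative_Group.nat_pow_mult_of)
  define z where "z = a [^] (2 * j)"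
  have z: "z \<in> carrier K" using aK by (simp add: z_def)
  have "z \<otimes> z = \<one>" using a_pow aK by (simp add: z_def nat_pow_mult)
  moreover have "z \<noteq> \<one>"
  proof
    assume "z = \<one>"
    \<comment> \<open>If \<open>z = 1\<close>, the powers of \<open>a\<close> repeat with period 2j,
      too few for a generator.\<close>
    have "a [^] i = a [^] (i mod (2 * j))" for i :: nat
    proof -
      have "a [^] i = a [^] (2 * j * (i div (2 * j)) + i mod (2 * j))" by simp
      also have "\<dots> = z [^] (i div (2 * j)) \<otimes> a [^] (i mod (2 * j))"
        using aK by (simp only: nat_pow_mult[symmetric] z_def nat_pow_pow)
      finally show ?thesis using aK \<open>z = \<one>\<close> by simp
    qed
    then have "carrier (Multiplicative_Group.mult_of K) \<subseteq> (\<lambda>i. a [^] i) ` {..<2 * j}"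
      unfolding a(2) using \<open>0 < j\<close>
      by (metis image_eqI image_subsetI lessThan_iff mod_less_divisor mult_pos_pos zero_less_numeral)
    then have "card (carrier (Multiplicative_Group.mult_of K)) \<le> 2 * j"
      using surj_card_le[of "{..<2 * j}" "carrier (Multiplicative_Group.mult_of K)" "\<lambda>i. a [^] i"]
      by simp
    then show False using card_mult \<open>0 < j\<close> by simp
  qed
  ultimately have "z = \<ominus> \<one>" using square_eq_one z by blast
  then have "(a [^] j) [^] (2::nat) = \<ominus> \<one>" using aK by (simp add: z_def nat_pow_pow mult.commute)
  then show ?thesis using aK unfolding minus_one_is_square_def by blast
qed

text \<open>Here q - 1 = 2j with j odd. A root y of -1 would give
  \<open>1 = y^(q - 1) = (-1)^j = -1\<close>, impossible in odd characteristic.\<close>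

lemma not_minus_one_is_square:
  assumes "\<not> 4 dvd q - 1"
  shows "\<not> minus_one_is_square K"
proof
  assume "minus_one_is_square K"
  then obtain y where y: "y \<in> carrier K" "y [^] (2::nat) = \<ominus> \<one>"
    by (auto simp: minus_one_is_square_def)
  have "y \<noteq> \<zero>"
  proof
    assume "y = \<zero>"
    then have "\<ominus> \<one> = \<zero>" using y by (simp add: numeral_2_eq_2)
    then show False by (metis add.inv_eq_1_iff one_closed zero_not_one)
  qed
  interpret G: group "Multiplicative_Group.mult_of K" by (rule field_mult_group)
  have "y [^] (q - 1) = \<one>"
    using G.pow_order_eq_1[of y] y \<open>y \<noteq> \<zero>\<close> finite_carrier
    by (simp add: Coset.order_def Multiplicative_Group.nat_pow_mult_of)
  moreover have "even (q - 1)" using odd_card by simp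
  then obtain j where j: "q - 1 = 2 * j" by (rule evenE)
  then have "odd j" using assms by (auto elim!: evenE)
  then obtain i where i: "j = 2 * i + 1" by (rule oddE)
  have sq: "(\<ominus> \<one>) [^] (2::nat) = \<one>" by (simp add: numeral_2_eq_2 l_minus)
  have "y [^] (q - 1) = (\<ominus> \<one>) [^] j"
    unfolding j using y by (simp flip: nat_pow_pow)
  also have "\<dots> = ((\<ominus> \<one>) [^] (2::nat)) [^] i \<otimes> \<ominus> \<one>"
    by (simp add: i nat_pow_pow)
  also have "\<dots> = \<ominus> \<one>" by (simp add: sq)
  finally show False using \<open>y [^] (q - 1) = \<one>\<close> minus_one_neq_one by simp
qed

end

section \<open>Necessary conditions\<close>

text \<open>The equation for \<open>a0\<close> says, with denominators cleared, that the fourth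
  vertex lies on the line from \<open>test_indicator\<close>. The bound \<open>k < d - 1\<close>
  permits dividing that inequality by \<open>d - 1 - k\<close>.\<close>

lemma exponent_point_in_trapezoid:
  fixes K :: "nat \<Rightarrow> 'a ring" and chi :: "nat \<Rightarrow> 'a \<Rightarrow> complex"
  assumes family: "\<And>q. primepow q \<Longrightarrow> odd q \<Longrightarrow> character_field (K q) (chi q) \<and> card (carrier (K q)) = q"
    and pr: "1 \<le> p" "1 \<le> r"
    and bounded: "extension_bounded adm K chi d p r"
    and flat: "\<And>N. \<exists>q\<ge>N. primepow q \<and> odd q \<and> adm (K q) \<and> flat_pair (K q) d k"
    and k: "k < d - 1"
    and a0: "0 < a0" "(1 - a0) * ((real d - 1 - real k) * (2 * real d)) = (real d - real k) * (real d - 1)"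
  shows "exponent_point p r \<in> convex hull
    {(1, 0), (0, 0), (0, (real d - 1) / (2 * real d)), (a0, (real d - 1) / (2 * real d))}"
proof -
  define a b where "a = enn2real (1 / p)" and "b = enn2real (1 / r)"
  have ab: "0 \<le> a" "0 \<le> b"
    using exponent_bounds[OF pr(1)] exponent_bounds[OF pr(2)] by (simp_all add: a_def b_def)
  \<comment> \<open>\<open>C\<close> is fixed before \<open>q\<close> is chosen, so both tests can
    be run along arbitrarily large admissible \<open>q\<close>.\<close>
  obtain C where C: "\<And>q. primepow q \<Longrightarrow> odd q \<Longrightarrow> adm (K q) \<Longrightarrow> extension_const (K q) (chi q) d p r \<le> C"
    using bounded by (auto simp: extension_bounded_def)
  have d: "1 \<le> d" using k by simp
  have "real d * b - (real d - 1) / 2 \<le> 0"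
  proof (rule powr_unbounded)
    fix N
    obtain q where q: "N \<le> q" "primepow q" "odd q" "adm (K q)" using flat by blast
    interpret character_field "K q" "chi q" using family q by blast
    show "\<exists>q\<ge>N. 0 < q \<and> real q powr (real d * b - (real d - 1) / 2) \<le> 2 * C"
      using test_constant[OF d pr C[OF q(2-4)]] family[OF q(2,3)] q
      by (auto simp: b_def primepow_gt_0_nat)
  qed
  then have b: "b \<le> (real d - 1) / (2 * real d)" using d by (simp add: field_simps)
  have "(real d - real k) * b - (real d - 1 - real k) * (1 - a) \<le> 0"
  proof (rule powr_unbounded)
    fix N
    obtain q where q: "N \<le> q" "primepow q" "odd q" "adm (K q)" and "flat_pair (K q) d k"
      using flat by blast
    then obtain H M where "H \<subseteq> paraboloid (K q) d" "card (carrier (K q)) ^ k \<le> card H"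
        "M \<subseteq> vecs (K q) d" "card (carrier (K q)) ^ (d - k) \<le> card M"
        "\<And>m \<xi>. m \<in> M \<Longrightarrow> \<xi> \<in> H \<Longrightarrow> dot (K q) d m \<xi> = \<zero>\<^bsub>K q\<^esub>"
      unfolding flat_pair_def by blast
    note HM = this
    interpret character_field "K q" "chi q" using family q by blast
    have "k \<le> d - 1" using k by simp
    from test_indicator[OF d pr C[OF q(2-4)] this HM]
    show "\<exists>q\<ge>N. 0 < q \<and> real q powr ((real d - real k) * b - (real d - 1 - real k) * (1 - a)) \<le> C"
      using family[OF q(2,3)] q by (auto simp: a_def b_def primepow_gt_0_nat)
  qed
  moreover have "0 < real d - 1 - real k" using k by simp
  ultimately have line: "a + (real d - real k) / (real d - 1 - real k) * b \<le> 1"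
    by (simp add: field_simps)
  have "0 < (real d - 1) / (2 * real d)" using k by simp
  moreover have "a0 + (real d - real k) / (real d - 1 - real k) * ((real d - 1) / (2 * real d)) = 1"
  proof -
    have "(real d - 1 - real k) * (2 * real d) \<noteq> 0" using k by auto
    then have "1 - a0 = (real d - real k) * (real d - 1) / ((real d - 1 - real k) * (2 * real d))"
      using a0(2) by (metis nonzero_mult_div_cancel_right)
    then show ?thesis by (simp only: times_divide_times_eq)
  qed
  ultimately show ?thesis
    using mem_convex_hull_trapezoid[OF a0(1) _ ab b line]
    by (simp add: exponent_point_def a_def b_def)
qed

text \<open>Used to verify the vertex equation in each case: \<open>D\<close> is the denominator of
  \<open>a0\<close>, and \<open>c * D\<close> rewrites \<open>(d - 1 - k) * 2 d\<close>.\<close>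

lemma one_minus_divide_mult:
  fixes c D n :: real
  assumes "D \<noteq> 0"
  shows "(1 - n / D) * (c * D) = c * (D - n)"
  using assms by (simp add: field_simps)

section \<open>Field sizes among the powers of 3\<close>

lemma nine_power_mod_4: "(9::nat) ^ n mod 4 = 1"
proof (induction n)
  case (Suc n)
  have "(9 * y) mod 4 = 1" if "y mod 4 = 1" for y :: nat using that by presburger
  from this[OF Suc.IH] show ?case by (simp only: power_Suc)
qed simp

lemma primepow_three_power: "0 < n \<Longrightarrow> primepow ((3::nat) ^ n)"
  by (subst primepow_prime_power) auto

text \<open>The exponent \<open>Suc n\<close> avoids \<open>9 ^ 0 = 1\<close>, which is not a prime
  power.\<close>

lemma nine_power: "primepow ((9::nat) ^ Suc n)" "odd ((9::nat) ^ Suc n)" "4 dvd (9::nat) ^ Suc n - 1"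
proof -
  have "(9::nat) = 3 ^ 2" by simp
  then have "(9::nat) ^ Suc n = 3 ^ (2 * Suc n)" by (simp only: power_mult)
  then show "primepow ((9::nat) ^ Suc n)" using primepow_three_power[of "2 * Suc n"] by simp
  have "4 dvd x - 1" if "x mod 4 = 1" for x :: nat using that by presburger
  then show "4 dvd (9::nat) ^ Suc n - 1" using nine_power_mod_4 by blast
qed simp

text \<open>An odd power of 3 is \<open>9 ^ n * 3\<close>, hence 3 modulo 4.\<close>

lemma odd_three_power:
  "primepow ((3::nat) ^ (2 * n + 1))" "odd ((3::nat) ^ (2 * n + 1))" "\<not> 4 dvd (3::nat) ^ (2 * n + 1) - 1"
proof -
  show "primepow ((3::nat) ^ (2 * n + 1))" by (rule primepow_three_power) simp
  have "(3::nat) ^ (2 * n + 1) = (3 ^ 2) ^ n * 3" by (simp only: power_add power_mult power_one_right)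
  also have "(3::nat) ^ 2 = 9" by simp
  finally have eq: "(3::nat) ^ (2 * n + 1) = 9 ^ n * 3" .
  have "\<not> 4 dvd y * 3 - 1" if "y mod 4 = 1" for y :: nat using that by presburger
  then show "\<not> 4 dvd (3::nat) ^ (2 * n + 1) - 1" unfolding eq using nine_power_mod_4 by blast
qed simp

theorem lemma2p3:
  fixes K :: "nat \<Rightarrow> 'a ring" and chi :: "nat \<Rightarrow> 'a \<Rightarrow> complex"
    and d :: nat and p r :: ennreal
  assumes field: "\<And>q. primepow q \<Longrightarrow> odd q \<Longrightarrow> field (K q) \<and> card (carrier (K q)) = q"
    and char: "\<And>q. primepow q \<Longrightarrow> odd q \<Longrightarrow> nontrivial_additive_character (K q) (chi q)"
    and "1 \<le> p" and "1 \<le> r"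
  shows
    "(2 \<le> d \<and> even d \<and> extension_bounded (\<lambda>_. True) K chi d p r \<longrightarrow>
        exponent_point p r \<in> convex hull
          {(1, 0), (0, 0), (0, (real d - 1) / (2 * real d)),
           (((real d)\<^sup>2 - real d + 2) / (2 * (real d)\<^sup>2), (real d - 1) / (2 * real d))}) \<and>
     ((\<exists>l\<ge>1. d = 4 * l - 1) \<and> extension_bounded (\<lambda>F. \<not> minus_one_is_square F) K chi d p r \<longrightarrow>
        exponent_point p r \<in> convex hull
          {(1, 0), (0, 0), (0, (real d - 1) / (2 * real d)),
           (((real d)\<^sup>2 + 3) / (2 * (real d)\<^sup>2 + 2 * real d), (real d - 1) / (2 * real d))}) \<and>
     ((\<exists>l\<ge>1. d = 4 * l + 1) \<and> extension_bounded (\<lambda>_. True) K chi d p r \<longrightarrow>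
        exponent_point p r \<in> convex hull
          {(1, 0), (0, 0), (0, (real d - 1) / (2 * real d)),
           ((real d - 1) / (2 * real d), (real d - 1) / (2 * real d))}) \<and>
     (3 \<le> d \<and> odd d \<and> extension_bounded minus_one_is_square K chi d p r \<longrightarrow>
        exponent_point p r \<in> convex hull
          {(1, 0), (0, 0), (0, (real d - 1) / (2 * real d)),
           ((real d - 1) / (2 * real d), (real d - 1) / (2 * real d))})"
proof (intro conjI impI; elim conjE)
  have family: "character_field (K q) (chi q) \<and> card (carrier (K q)) = q" if "primepow q" "odd q" for q
    using field[OF that] char[OF that] that(2)
    by (simp add: character_field_def character_field_axioms_def)
  have square: "\<exists>q\<ge>N. primepow q \<and> odd q \<and> minus_one_is_square (K q) \<and> flat_pair (K q) d k"
    if k: "2 * k < d" for N k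
  proof (intro exI conjI)
    let ?q = "(9::nat) ^ Suc N"
    show "primepow ?q" "odd ?q" by (rule nine_power)+
    note fam = family[OF this]
    interpret character_field "K ?q" "chi ?q" using fam by blast
    show "minus_one_is_square (K ?q)"
      using fam nine_power(3) by (intro minus_one_is_square_if_dvd) simp
    then show "flat_pair (K ?q) d k" using k by (rule flat_pair_of_sqrt_minus_one)
    show "N \<le> ?q" using less_exp[of "Suc N"] power_mono[of 2 "9::nat" "Suc N"] by linarith
  qed
  have nonsquare: "\<exists>q\<ge>N. primepow q \<and> odd q \<and> \<not> minus_one_is_square (K q) \<and> flat_pair (K q) d (2 * k)"
    if k: "4 * k < d" for N k
  proof (intro exI conjI)
    let ?q = "(3::nat) ^ (2 * N + 1)"
    show "primepow ?q" "odd ?q" by (rule odd_three_power)+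
    note fam = family[OF this]
    interpret character_field "K ?q" "chi ?q" using fam by blast
    show "\<not> minus_one_is_square (K ?q)"
      using fam odd_three_power(3)[of N] by (intro not_minus_one_is_square) simp
    show "flat_pair (K ?q) d (2 * k)"
      using k char_three[of "2 * N + 1"] fam by (intro flat_pair_of_char_three) auto
    show "N \<le> ?q" using less_exp[of "2 * N + 1"] power_mono[of 2 "3::nat" "2 * N + 1"] by linarith
  qed
  \<comment> \<open>This serves (3) and (4) alike: in (3) all odd \<open>q\<close> are admissible,
    so those with -1 a square may be selected. The flat has the largest dimension allowed by
    \<open>square\<close>, namely k = (d - 1) / 2.\<close>
  have odd_case: "exponent_point p r \<in> convex hull
      {(1, 0), (0, 0), (0, (real d - 1) / (2 * real d)),
       ((real d - 1) / (2 * real d), (real d - 1) / (2 * real d))}"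
    if d: "3 \<le> d" "odd d" and bounded: "extension_bounded adm K chi d p r"
      and adm: "\<And>F. minus_one_is_square F \<Longrightarrow> adm F" for adm
  proof -
    obtain k where k: "d = 2 * k + 1" using d(2) by (rule oddE)
    show ?thesis
    proof (rule exponent_point_in_trapezoid[OF family assms(3,4) bounded])
      show "\<exists>q\<ge>N. primepow q \<and> odd q \<and> adm (K q) \<and> flat_pair (K q) d k" for N
        using square[of k N] k adm by (metis less_add_one)
      show "k < d - 1" "0 < (real d - 1) / (2 * real d)" using d k by auto
      have kd: "real k = (real d - 1) / 2" using k by simp
      have eq: "(real d - 1 - real k) * (2 * real d) = real k * (2 * real d)" by (simp add: kd field_simps)
      have D: "2 * real d \<noteq> 0" using d by simp
      have "(1 - (real d - 1) / (2 * real d)) * ((real d - 1 - real k) * (2 * real d))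
          = real k * (2 * real d - (real d - 1))"
        unfolding eq by (rule one_minus_divide_mult[OF D])
      also have "\<dots> = (real d - real k) * (real d - 1)" by (simp add: kd field_simps)
      finally show "(1 - (real d - 1) / (2 * real d)) * ((real d - 1 - real k) * (2 * real d))
          = (real d - real k) * (real d - 1)" .
    qed
  qed
  {
    assume d: "2 \<le> d" "even d" and bounded: "extension_bounded (\<lambda>_. True) K chi d p r"
    obtain j where "d = 2 * j" using d(2) by (rule evenE)
    \<comment> \<open>For even d the condition \<open>2 * k < d\<close> allows at most k = (d - 2) /
      2, which gives \<open>d - 1 - k = d / 2\<close>.\<close>
    with d(1) obtain k where k: "d = 2 * k + 2" by (cases j) auto
    show "exponent_point p r \<in> convex hull
        {(1, 0), (0, 0), (0, (real d - 1) / (2 * real d)),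
         (((real d)\<^sup>2 - real d + 2) / (2 * (real d)\<^sup>2), (real d - 1) / (2 * real d))}"
    proof (rule exponent_point_in_trapezoid[OF family assms(3,4) bounded])
      show "\<exists>q\<ge>N. primepow q \<and> odd q \<and> True \<and> flat_pair (K q) d k" for N
      proof -
        have "2 * k < d" using k by simp
        then show ?thesis using square by blast
      qed
      show "k < d - 1" using k by simp
      have "real d \<le> (real d)\<^sup>2" using d by (intro self_le_power) auto
      then have "0 < (real d)\<^sup>2 - real d + 2" by linarith
      moreover have "0 < 2 * (real d)\<^sup>2" using d by simp
      ultimately show "0 < ((real d)\<^sup>2 - real d + 2) / (2 * (real d)\<^sup>2)"
        by (rule divide_pos_pos)
      have kd: "real k = (real d - 2) / 2" using k by simp
      have eq: "(real d - 1 - real k) * (2 * real d) = 1 / 2 * (2 * (real d)\<^sup>2)"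
        by (simp add: kd field_simps power2_eq_square)
      have D: "2 * (real d)\<^sup>2 \<noteq> 0" using d by simp
      have "(1 - ((real d)\<^sup>2 - real d + 2) / (2 * (real d)\<^sup>2))
            * ((real d - 1 - real k) * (2 * real d))
          = 1 / 2 * (2 * (real d)\<^sup>2 - ((real d)\<^sup>2 - real d + 2))"
        unfolding eq by (rule one_minus_divide_mult[OF D])
      also have "\<dots> = (real d - real k) * (real d - 1)"
        by (simp add: kd field_simps power2_eq_square)
      finally show "(1 - ((real d)\<^sup>2 - real d + 2) / (2 * (real d)\<^sup>2))
            * ((real d - 1 - real k) * (2 * real d)) = (real d - real k) * (real d - 1)" .
    qed
  }
  {
    assume "\<exists>l\<ge>1. d = 4 * l - 1"
      and bounded: "extension_bounded (\<lambda>F. \<not> minus_one_is_square F) K chi d p r"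
    then obtain l where "1 \<le> l" "d = 4 * l - 1" by blast
    \<comment> \<open>Here k = l - 1, so the flat of dimension 2k = (d - 3) / 2 needs 4k = d - 3
      coordinates plus the last one. For d = 3 it is the origin alone.\<close>
    then obtain k where k: "d = 4 * k + 3" by (cases l) auto
    show "exponent_point p r \<in> convex hull
        {(1, 0), (0, 0), (0, (real d - 1) / (2 * real d)),
         (((real d)\<^sup>2 + 3) / (2 * (real d)\<^sup>2 + 2 * real d), (real d - 1) / (2 * real d))}"
    proof (rule exponent_point_in_trapezoid[OF family assms(3,4) bounded])
      show "\<exists>q\<ge>N. primepow q \<and> odd q \<and> \<not> minus_one_is_square (K q) \<and> flat_pair (K q) d (2 * k)" for N
      proof -
        have "4 * k < d" using k by simp
        then show ?thesis by (rule nonsquare)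
      qed
      show "2 * k < d - 1" using k by simp
      show "0 < ((real d)\<^sup>2 + 3) / (2 * (real d)\<^sup>2 + 2 * real d)"
        using k by (intro divide_pos_pos add_nonneg_pos) auto
      have kd: "real (2 * k) = (real d - 3) / 2" using k by simp
      have eq: "(real d - 1 - real (2 * k)) * (2 * real d) = 1 / 2 * (2 * (real d)\<^sup>2 + 2 * real d)"
        unfolding kd by (simp add: field_simps power2_eq_square)
      have "0 < 2 * (real d)\<^sup>2 + 2 * real d" using k by (intro add_nonneg_pos) auto
      then have D: "2 * (real d)\<^sup>2 + 2 * real d \<noteq> 0" by simp
      have "(1 - ((real d)\<^sup>2 + 3) / (2 * (real d)\<^sup>2 + 2 * real d))
            * ((real d - 1 - real (2 * k)) * (2 * real d))
          = 1 / 2 * (2 * (real d)\<^sup>2 + 2 * real d - ((real d)\<^sup>2 + 3))"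
        unfolding eq by (rule one_minus_divide_mult[OF D])
      also have "\<dots> = (real d - real (2 * k)) * (real d - 1)"
        unfolding kd by (simp add: field_simps power2_eq_square)
      finally show "(1 - ((real d)\<^sup>2 + 3) / (2 * (real d)\<^sup>2 + 2 * real d))
            * ((real d - 1 - real (2 * k)) * (2 * real d)) = (real d - real (2 * k)) * (real d - 1)" .
    qed
  }
  {
    assume "\<exists>l\<ge>1. d = 4 * l + 1" and bounded: "extension_bounded (\<lambda>_. True) K chi d p r"
    then have "3 \<le> d" "odd d" by auto
    then show "exponent_point p r \<in> convex hull
        {(1, 0), (0, 0), (0, (real d - 1) / (2 * real d)),
         ((real d - 1) / (2 * real d), (real d - 1) / (2 * real d))}"
      using bounded by (rule odd_case) simp
  }
  assume "3 \<le> d" "odd d" "extension_bounded minus_one_is_square K chi d p r"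
  then show "exponent_point p r \<in> convex hull
      {(1, 0), (0, 0), (0, (real d - 1) / (2 * real d)),
       ((real d - 1) / (2 * real d), (real d - 1) / (2 * real d))}"
    by (rule odd_case)
qed

end
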